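(* Let $G$ be a graph. Let $w$ be a nonnegative integer. 1. If the tree-cut torso-width of $G$ is at most $w$, then the carving-width of $G$ is at most $w$ and there exists no edge-tangle of order $w+1$ in $G$. 2. If the carving-width of $G$ is at most $w$ and $G$ is loopless, then the tree-cut torso-width of $G$ is at most $3w/2$. 3. If $w\ge 1$ and there exists no edge-tangle of order $w$ in $G$, then the tree-cut torso-width of $G$ is at most $3w-3$.
   Context: Graphs are finite and may have loops and parallel edges. An edge-cut $[A,B]$ of $G$ is an ordered pair of disjoint subsets of $V(G)$ with $A\cup B=V(G)$; its order is the number of edges of $G$ with one end in $A$ and one end in $B$. A tree-cut decomposition of $G$ is a pair $(T,\mathcal{X})$ where $T$ is a tree and $\mathcal{X}=(X_t:t\in V(T))$ is a collection of pairwise disjoint (possibly empty) subsets of $V(G)$ with $\bigcup_{t\in V(T)}X_t=V(G)$. For a subgraph $S$ of $T$, $X_S=\bigcup_{t\in V(S)}X_t$. For an edge $t_1t_2$ of $T$, the adhesion set of $t_1t_2$ is the set of edges of $G$ with one end in $X_{T_1}$ and one end in $X_{T_2}$, where $T_1,T_2$ are the components of $T-t_1t_2$. The adhesion of $(T,\mathcal{X})$ is the maximum size of an adhesion set over all edges of $T$. For a node $t$ of $T$, the torso at $t$ is the graph obtained from $G$ by, for each component $T'$ of $T-t$, identifying $X_{T'}$ into a single new vertex and deleting all loops incident with this new vertex. The torso-width of $(T,\mathcal{X})$ is the minimum $w$ such that for every $t\in V(T)$ the torso at $t$ has at most $w$ edges. The tree-cut torso-width of $G$ is the minimum $w$ such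 that $G$ admits a tree-cut decomposition of torso-width $w$. A tree-cut decomposition $(T,\mathcal{X})$ is a weak carving if $|X_t|=1$ for every leaf $t$ of $T$ and $X_t=\emptyset$ for every non-leaf node $t$ of $T$; it is a carving if it is a weak carving and every node of $T$ has degree 1 or 3. The carving-width of $G$ is the minimum $w$ such that $G$ admits a tree-cut decomposition that is a carving of adhesion at most $w$ (understood to be $0$ if $|V(G)|\le 1$). For a positive integer $\theta$, an edge-tangle $\mathcal{E}$ of order $\theta$ in $G$ is a set of edge-cuts of $G$ of order less than $\theta$ such that: (E1) for every edge-cut $[A,B]$ of $G$ of order less than $\theta$, either $[A,B]\in\mathcal{E}$ or $[B,A]\in\mathcal{E}$; (E2) if $[A_1,B_1],[A_2,B_2],[A_3,B_3]\in\mathcal{E}$, then $B_1\cap B_2\cap B_3\ne\emptyset$; (E3) if $[A,B]\in\mathcal{E}$, then $G$ has at least $\theta$ edges incident with vertices in $B$. *)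

theory Defs
  imports Complex_Main "HOL-Library.Disjoint_Sets"
begin

section \<open>Finite multigraphs\<close>

text \<open>Undirected graphs with loops and parallel edges: an edge has one end if it is a loop
  and two ends otherwise. The graph without vertices is allowed.\<close>

record ('v, 'e) mgraph =
  verts :: "'v set"
  edges :: "'e set"
  ends :: "'e \<Rightarrow> 'v set"

locale multigraph =
  fixes G :: "('v, 'e) mgraph"
  assumes finite_verts: "finite (verts G)"
    and finite_edges: "finite (edges G)"
    and ends_in_verts: "e \<in> edges G \<Longrightarrow> ends G e \<subseteq> verts G"
    and card_ends: "e \<in> edges G \<Longrightarrow> card (ends G e) = 1 \<or> card (ends G e) = 2"

definition loopless :: "('v, 'e) mgraph \<Rightarrow> bool" where
  "loopless G \<longleftrightarrow> (\<forall>e\<in>edges G. card (ends G e) \<noteq> 1)"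

definition incident_edges :: "('v, 'e) mgraph \<Rightarrow> 'v set \<Rightarrow> 'e set" where
  "incident_edges G B = {e \<in> edges G. ends G e \<inter> B \<noteq> {}}"

definition edges_between :: "('v, 'e) mgraph \<Rightarrow> 'v set \<Rightarrow> 'v set \<Rightarrow> 'e set" where
  "edges_between G A B = {e \<in> edges G. \<exists>a\<in>A. \<exists>b\<in>B. ends G e = {a, b}}"

text \<open>A loop contributes two to the degree.\<close>

definition vertex_degree :: "('v, 'e) mgraph \<Rightarrow> 'v \<Rightarrow> nat" where
  "vertex_degree G v =
     card {e \<in> edges G. v \<in> ends G e} + card {e \<in> edges G. ends G e = {v}}"

definition adjacency :: "('v, 'e) mgraph \<Rightarrow> ('v \<times> 'v) set" where
  "adjacency G = {(u, v). \<exists>e\<in>edges G. ends G e = {u, v}}"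

text \<open>A component is represented by its vertex set.\<close>

definition graph_components :: "('v, 'e) mgraph \<Rightarrow> 'v set set" where
  "graph_components G = {{u \<in> verts G. (v, u) \<in> (adjacency G)\<^sup>*} | v. v \<in> verts G}"

definition graph_connected :: "('v, 'e) mgraph \<Rightarrow> bool" where
  "graph_connected G \<longleftrightarrow>
     verts G \<noteq> {} \<and> (\<forall>u\<in>verts G. \<forall>v\<in>verts G. (u, v) \<in> (adjacency G)\<^sup>*)"

definition delete_vertex :: "('v, 'e) mgraph \<Rightarrow> 'v \<Rightarrow> ('v, 'e) mgraph" where
  "delete_vertex G v =
     \<lparr>verts = verts G - {v}, edges = {e \<in> edges G. v \<notin> ends G e}, ends = ends G\<rparr>"

definition delete_edge :: "('v, 'e) mgraph \<Rightarrow> 'e \<Rightarrow> ('v, 'e) mgraph" where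
  "delete_edge G f = \<lparr>verts = verts G, edges = edges G - {f}, ends = ends G\<rparr>"

text \<open>A cycle with vertices \<open>vs\<close> and edges \<open>es\<close> in cyclic order. Length 1 gives a loop,
  length 2 a pair of parallel edges.\<close>

definition is_cycle :: "('v, 'e) mgraph \<Rightarrow> 'v list \<Rightarrow> 'e list \<Rightarrow> bool" where
  "is_cycle G vs es \<longleftrightarrow>
     vs \<noteq> [] \<and> length es = length vs \<and> distinct vs \<and> distinct es \<and> set es \<subseteq> edges G \<and>
     (\<forall>i<length vs. ends G (es ! i) = {vs ! i, vs ! (Suc i mod length vs)})"

definition is_tree :: "('v, 'e) mgraph \<Rightarrow> bool" where
  "is_tree T \<longleftrightarrow> multigraph T \<and> graph_connected T \<and> (\<nexists>vs es. is_cycle T vs es)"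

section \<open>Tree-cut decompositions\<close>

definition tree_cut_decomposition ::
    "('v, 'e) mgraph \<Rightarrow> ('t, 'f) mgraph \<Rightarrow> ('t \<Rightarrow> 'v set) \<Rightarrow> bool" where
  "tree_cut_decomposition G T X \<longleftrightarrow>
     is_tree T \<and> disjoint_family_on X (verts T) \<and> (\<Union>t\<in>verts T. X t) = verts G"

definition bag_union :: "('t \<Rightarrow> 'v set) \<Rightarrow> 't set \<Rightarrow> 'v set" where
  "bag_union X S = (\<Union>t\<in>S. X t)"

definition adhesion_set ::
    "('v, 'e) mgraph \<Rightarrow> ('t, 'f) mgraph \<Rightarrow> ('t \<Rightarrow> 'v set) \<Rightarrow> 'f \<Rightarrow> 'e set" where
  "adhesion_set G T X f =
     {e. \<exists>T1 T2. graph_components (delete_edge T f) = {T1, T2} \<and> T1 \<noteq> T2 \<and>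
           e \<in> edges_between G (bag_union X T1) (bag_union X T2)}"

text \<open>The inserted 0 only matters when \<open>T\<close> has no edges.\<close>

definition adhesion :: "('v, 'e) mgraph \<Rightarrow> ('t, 'f) mgraph \<Rightarrow> ('t \<Rightarrow> 'v set) \<Rightarrow> nat" where
  "adhesion G T X = Max (insert 0 ((\<lambda>f. card (adhesion_set G T X f)) ` edges T))"

text \<open>In the torso at \<open>t\<close>, \<open>Inl v\<close> is the original vertex \<open>v \<in> X t\<close>, and \<open>Inr C\<close> is the new
  vertex into which the bags of the component \<open>C\<close> of \<open>T - t\<close> are identified. Loops at
  vertices of \<open>X t\<close> are kept, and edges between distinct new vertices stay parallel.\<close>

definition torso_ends ::
    "('v, 'e) mgraph \<Rightarrow> ('t, 'f) mgraph \<Rightarrow> ('t \<Rightarrow> 'v set) \<Rightarrow> 't \<Rightarrow> 'e \<Rightarrow> ('v + 't set) set" where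
  "torso_ends G T X t e =
     Inl ` (ends G e \<inter> X t) \<union>
     Inr ` {C \<in> graph_components (delete_vertex T t). ends G e \<inter> bag_union X C \<noteq> {}}"

definition torso ::
    "('v, 'e) mgraph \<Rightarrow> ('t, 'f) mgraph \<Rightarrow> ('t \<Rightarrow> 'v set) \<Rightarrow> 't \<Rightarrow> ('v + 't set, 'e) mgraph" where
  "torso G T X t =
     \<lparr>verts = Inl ` X t \<union> Inr ` graph_components (delete_vertex T t),
      edges = {e \<in> edges G. \<nexists>C. C \<in> graph_components (delete_vertex T t) \<and>
                 torso_ends G T X t e = {Inr C}},
      ends = torso_ends G T X t\<rparr>"

definition torso_width :: "('v, 'e) mgraph \<Rightarrow> ('t, 'f) mgraph \<Rightarrow> ('t \<Rightarrow> 'v set) \<Rightarrow> nat" where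
  "torso_width G T X = (LEAST w. \<forall>t\<in>verts T. card (edges (torso G T X t)) \<le> w)"

text \<open>As trees are finite, letting the nodes and edges of \<open>T\<close> be natural numbers loses no
  decomposition up to isomorphism, here and for carvings below.\<close>

definition tree_cut_torso_width :: "('v, 'e) mgraph \<Rightarrow> nat" where
  "tree_cut_torso_width G =
     (LEAST w. \<exists>(T :: (nat, nat) mgraph) X.
        tree_cut_decomposition G T X \<and> torso_width G T X = w)"

section \<open>Carvings\<close>

definition is_leaf :: "('t, 'f) mgraph \<Rightarrow> 't \<Rightarrow> bool" where
  "is_leaf T t \<longleftrightarrow> t \<in> verts T \<and> vertex_degree T t = 1"

definition weak_carving ::
    "('v, 'e) mgraph \<Rightarrow> ('t, 'f) mgraph \<Rightarrow> ('t \<Rightarrow> 'v set) \<Rightarrow> bool" where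
  "weak_carving G T X \<longleftrightarrow>
     tree_cut_decomposition G T X \<and>
     (\<forall>t\<in>verts T. if is_leaf T t then card (X t) = 1 else X t = {})"

definition carving :: "('v, 'e) mgraph \<Rightarrow> ('t, 'f) mgraph \<Rightarrow> ('t \<Rightarrow> 'v set) \<Rightarrow> bool" where
  "carving G T X \<longleftrightarrow>
     weak_carving G T X \<and> (\<forall>t\<in>verts T. vertex_degree T t = 1 \<or> vertex_degree T t = 3)"

definition carving_width :: "('v, 'e) mgraph \<Rightarrow> nat" where
  "carving_width G =
     (if card (verts G) \<le> 1 then 0
      else LEAST w. \<exists>(T :: (nat, nat) mgraph) X. carving G T X \<and> adhesion G T X \<le> w)"

section \<open>Edge-tangles\<close>

definition edge_cut :: "('v, 'e) mgraph \<Rightarrow> 'v set \<Rightarrow> 'v set \<Rightarrow> bool" where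
  "edge_cut G A B \<longleftrightarrow> A \<inter> B = {} \<and> A \<union> B = verts G"

definition cut_order :: "('v, 'e) mgraph \<Rightarrow> 'v set \<Rightarrow> 'v set \<Rightarrow> nat" where
  "cut_order G A B = card (edges_between G A B)"

definition edge_tangle :: "('v, 'e) mgraph \<Rightarrow> nat \<Rightarrow> ('v set \<times> 'v set) set \<Rightarrow> bool" where
  "edge_tangle G \<theta> \<E> \<longleftrightarrow>
     \<theta> > 0 \<and>
     (\<forall>(A, B)\<in>\<E>. edge_cut G A B \<and> cut_order G A B < \<theta>) \<and>
     (\<forall>A B. edge_cut G A B \<and> cut_order G A B < \<theta> \<longrightarrow> (A, B) \<in> \<E> \<or> (B, A) \<in> \<E>) \<and>
     (\<forall>A1 B1 A2 B2 A3 B3. (A1, B1) \<in> \<E> \<and> (A2, B2) \<in> \<E> \<and> (A3, B3) \<in> \<E> \<longrightarrow>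
        B1 \<inter> B2 \<inter> B3 \<noteq> {}) \<and>
     (\<forall>(A, B)\<in>\<E>. card (incident_edges G B) \<ge> \<theta>)"

end

theory Submission imports Defs
begin

text \<open>Every decomposition constructed below comes from an assembly: a vertex set is built from small
  pieces by repeated disjoint unions in such a way that all intermediate sets have few edges
  leaving them. An assembly is a rooted binary tree, and with one more leaf attached above its root
  this tree carries a tree-cut decomposition whose adhesion sets are the cuts at the intermediate
  sets (locale \<open>heap\<close>).

  Suppose that all torsos have at most \<open>w\<close> edges. At each node, the branches and the
  vertices of the bag are the vertices of the torso, so every union of them is left by at most \<open>w\<close>
  edges. Working inwards along the tree, this assembles all of the graph except one vertex \<open>v\<close> from
  single vertices (\<open>assembled_delete_vertex\<close>); with \<open>v\<close> in the additional leaf the tree is a carving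
  of adhesion at most \<open>w\<close>. It also lets an edge-tangle of order \<open>w + 1\<close> choose a side of
  each of these unions. The tree has a node all of whose branches are on the small side; then their
  union is small, too, and the bag of this node must meet more than \<open>w\<close> edges, all of which are in
  the torso (\<open>no_edge_tangle\<close>).

  In a carving of adhesion at most \<open>w\<close>, a torso at an inner node has three vertices and each of
  its edges is counted in two of the three cuts of size at most \<open>w\<close>; at a leaf there is one cut,
  which contains the whole torso if there are no loops (\<open>torso_edges_carving\<close>).

  Finally, if there is no edge-tangle of order \<open>w\<close>, then the vertex set can be assembled, with cuts
  of size below \<open>w\<close>, from pieces that meet fewer than \<open>w\<close> edges. This is a duality that holds for
  all symmetric submodular functions: a maximal family of sets of low value that is closed under
  passing to such subsets and does not assemble the ground set consists of the small sides of a
  tangle (\<open>tangle_if_not_assembled\<close>). A torso of the resulting tree has at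
  most \<open>2 * (w - 1)\<close> edges, since its edges meet one piece or cross one of two sets.\<close>

section \<open>Symmetric submodular functions and the duality with tangles\<close>

text \<open>The sets obtained from pieces in \<open>L\<close> by disjoint unions all of which satisfy \<open>P\<close>. A derivation
  is a rooted binary tree whose leaves are the pieces; a decomposition tree is read off from it.\<close>

inductive assembled :: "('a set \<Rightarrow> bool) \<Rightarrow> ('a set \<Rightarrow> bool) \<Rightarrow> 'a set \<Rightarrow> bool"
  for P L where
    leaf: "L S \<Longrightarrow> P S \<Longrightarrow> assembled P L S"
  | join: "assembled P L A \<Longrightarrow> assembled P L B \<Longrightarrow> A \<inter> B = {} \<Longrightarrow> P (A \<union> B)
            \<Longrightarrow> assembled P L (A \<union> B)"

lemma assembled_imp: "assembled P L S \<Longrightarrow> P S"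
  by (auto elim: assembled.cases)

text \<open>The parts are joined one at a time, in any order; empty parts are skipped because they need
  not be assembled from pieces.\<close>

lemma assembled_Union:
  assumes "finite F"
    and "\<And>A B. A \<in> F \<Longrightarrow> B \<in> F \<Longrightarrow> A \<noteq> B \<Longrightarrow> A \<inter> B = {}"
    and "\<And>F'. F' \<subseteq> F \<Longrightarrow> P (\<Union>F')"
    and "\<And>A. A \<in> F \<Longrightarrow> A = {} \<or> assembled P L A"
  shows "\<Union>F = {} \<or> assembled P L (\<Union>F)"
  using assms
proof (induction rule: finite_induct)
  case (insert A F)
  have IH: "\<Union>F = {} \<or> assembled P L (\<Union>F)"
    by (rule insert.IH) (use insert.prems in \<open>blast intro: insert.prems\<close>)+
  have "A \<inter> \<Union>F = {}"
    using insert.prems(1) insert.hyps by blast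
  moreover have "P (A \<union> \<Union>F)"
    using insert.prems(2)[of "insert A F"] by simp
  moreover have "A = {} \<or> assembled P L A"
    using insert.prems(3) by simp
  moreover have "\<Union> (insert A F) = A \<union> \<Union>F"
    by simp
  ultimately show ?case
    using IH assembled.join[of P L A "\<Union>F"] by (metis Un_empty_left Un_empty_right)
qed simp

locale connectivity_function =
  fixes V :: "'a set" and d :: "'a set \<Rightarrow> nat"
  assumes finite_ground: "finite V"
    and d_compl: "A \<subseteq> V \<Longrightarrow> d (V - A) = d A"
    and submodular: "A \<subseteq> V \<Longrightarrow> B \<subseteq> V \<Longrightarrow> d (A \<inter> B) + d (A \<union> B) \<le> d A + d B"
begin

definition low :: "nat \<Rightarrow> 'a set \<Rightarrow> bool" where
  "low k S \<longleftrightarrow> S \<subseteq> V \<and> d S < k"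

lemma low_compl: "low k S \<Longrightarrow> low k (V - S)"
  by (auto simp: low_def d_compl)

lemma low_empty:
  assumes "low k A"
  shows "low k {}"
proof -
  have "A \<union> (V - A) = V"
    using assms by (auto simp: low_def)
  then have "d {} + d V \<le> d A + d (V - A)"
    using submodular[of A "V - A"] assms by (simp add: low_def)
  then show ?thesis
    using d_compl[of "{}"] d_compl[of A] assms by (simp add: low_def)
qed

lemma posimodular:
  assumes "A \<subseteq> V" "B \<subseteq> V"
  shows "d (A - B) + d (B - A) \<le> d A + d B"
proof -
  have "A \<inter> (V - B) = A - B" "V - (A \<union> (V - B)) = B - A"
    using assms by auto
  then have "d (A - B) + d (B - A) = d (A \<inter> (V - B)) + d (A \<union> (V - B))"
    using d_compl[of "A \<union> (V - B)"] assms by auto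
  also have "\<dots> \<le> d A + d (V - B)"
    using submodular[of A "V - B"] assms by auto
  finally show ?thesis
    using d_compl[of B] assms by simp
qed

text \<open>Intersecting every set of the assembly with \<open>S'\<close> does not increase its value, since the
  corresponding union lies between \<open>S'\<close> and \<open>S\<close> and so has value at least \<open>d S'\<close>.\<close>

lemma assembled_shrink:
  assumes S: "assembled (low k) L S"
    and sub: "S' \<subseteq> S"
    and min: "\<And>Z. S' \<subseteq> Z \<Longrightarrow> Z \<subseteq> S \<Longrightarrow> d S' \<le> d Z"
    and closed: "\<And>A B. L A \<Longrightarrow> B \<subseteq> A \<Longrightarrow> low k B \<Longrightarrow> L B"
  shows "assembled (low k) L S'"
proof -
  have SV: "S \<subseteq> V"
    using assembled_imp[OF S] by (simp add: low_def)
  have low': "low k (Y \<inter> S')" if "low k Y" "Y \<subseteq> S" for Y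
  proof -
    have "d S' \<le> d (Y \<union> S')"
      using min that sub by auto
    moreover have "d (Y \<inter> S') + d (Y \<union> S') \<le> d Y + d S'"
      using submodular that sub SV by (meson order_trans)
    ultimately show ?thesis
      using that by (auto simp: low_def)
  qed
  have "assembled (low k) L (Y \<inter> S')" if "assembled (low k) L Y" "Y \<subseteq> S" for Y
    using that
  proof (induction rule: assembled.induct)
    case (leaf Y)
    then show ?case
      using closed low' by (blast intro: assembled.leaf)
  next
    case (join A B)
    have "low k ((A \<union> B) \<inter> S')"
      using low' join by blast
    then show ?case
      using assembled.join[of "low k" L "A \<inter> S'" "B \<inter> S'"] join
      by (auto simp: Int_Un_distrib2)
  qed
  from this[OF S] show ?thesis
    using sub by (simp add: Int_absorb1)
qed

text \<open>The pieces are disjoint, so the additional piece \<open>R\<close> occurs only once in an assembly, and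
  the binary tree of the assembly can be rooted there instead.\<close>

lemma assembled_reroot:
  assumes S: "assembled (low k) (\<lambda>X. L X \<or> X = R) S" and "R \<noteq> {}"
  shows "assembled (low k) L S \<or>
    R \<subseteq> S \<and> (assembled (low k) L (V - S) \<longrightarrow> assembled (low k) L (V - R))"
  using S
proof (induction rule: assembled.induct)
  case (leaf S)
  then show ?case
    by (auto intro: assembled.leaf)
next
  case (join A B)
  have *: "R \<subseteq> A \<union> B \<and> (assembled (low k) L (V - (A \<union> B)) \<longrightarrow> assembled (low k) L (V - R))"
    if A: "low k A" "R \<subseteq> A" "assembled (low k) L (V - A) \<longrightarrow> assembled (low k) L (V - R)"
      and B: "assembled (low k) L B" and disj: "A \<inter> B = {}" for A B
  proof -
    have "assembled (low k) L (V - A)" if "assembled (low k) L (V - (A \<union> B))"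
    proof -
      have eq: "V - A = (V - (A \<union> B)) \<union> B"
        using assembled_imp[OF B] disj by (auto simp: low_def)
      show ?thesis
        unfolding eq using that B low_compl[OF A(1)]
        by (intro assembled.join) (auto simp flip: eq)
    qed
    with A show ?thesis by blast
  qed
  have lows: "low k A" "low k B"
    using join.hyps assembled_imp by auto
  consider "assembled (low k) L A" "assembled (low k) L B"
    | "assembled (low k) L B" "R \<subseteq> A" "assembled (low k) L (V - A) \<longrightarrow> assembled (low k) L (V - R)"
    | "assembled (low k) L A" "R \<subseteq> B" "assembled (low k) L (V - B) \<longrightarrow> assembled (low k) L (V - R)"
    | "R \<subseteq> A" "R \<subseteq> B"
    using join.IH by blast
  then show ?case
  proof cases
    case 1
    then show ?thesis using join.hyps by (blast intro: assembled.join)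
  next
    case 2
    then show ?thesis using *[of A B] lows join.hyps by blast
  next
    case 3
    then show ?thesis using *[of B A] lows join.hyps by (simp add: Un_commute[of A B] Int_commute[of A B])
  next
    case 4
    then show ?thesis using \<open>R \<noteq> {}\<close> join.hyps by blast
  qed
qed

text \<open>Posimodularity lets one of two overlapping members of a cover give up the overlap without
  increasing its value. Hence a smallest cover by three members is a partition.\<close>

lemma assembled_if_triple_cover:
  assumes low: "\<And>A. L A \<Longrightarrow> low k A"
    and closed: "\<And>A B. L A \<Longrightarrow> B \<subseteq> A \<Longrightarrow> low k B \<Longrightarrow> L B"
    and ABC: "L A" "L B" "L C" "A \<union> B \<union> C = V"
  shows "assembled (low k) L V"
  using ABC
proof (induction "card A + card B + card C" arbitrary: A B C rule: less_induct)
  case less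
  have uncross: "L (A - B) \<or> L (B - A)" if "L A" "L B" for A B
  proof -
    have "low k A" "low k B" using low that by auto
    moreover from this have "d (A - B) \<le> d A \<or> d (B - A) \<le> d B"
      using posimodular[of A B] by (auto simp: low_def)
    ultimately have "low k (A - B) \<or> low k (B - A)"
      by (auto simp: low_def)
    then show ?thesis using closed that by blast
  qed
  have shrink: "card (A - B) < card A" if "finite A" "A \<inter> B \<noteq> {}" for A B :: "'a set"
    using that by (metis Diff_disjoint Diff_subset Int_absorb1 inf_commute psubsetI psubset_card_mono)
  show ?case
  proof (cases "A \<inter> B = {} \<and> A \<inter> C = {} \<and> B \<inter> C = {}")
    case True
    have "A \<union> B = V - C"
      using True less.prems by blast
    then have "low k (A \<union> B)"
      using low_compl low less.prems by metis
    then have "assembled (low k) L (A \<union> B)"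
      using True low less.prems by (intro assembled.join assembled.leaf) auto
    moreover have "low k V"
      using low_compl[OF low_empty] low less.prems(1) by force
    moreover have "assembled (low k) L C" "(A \<union> B) \<inter> C = {}"
      using True low less.prems by (auto intro: assembled.leaf)
    ultimately show ?thesis
      using assembled.join[of "low k" L "A \<union> B" C] unfolding less.prems(4) by blast
  next
    case False
    have step: "assembled (low k) L V"
      if "L A'" "L B'" "L C'" "A' \<union> B' \<union> C' = V" "A' \<inter> B' \<noteq> {}"
        and card: "card A' + card B' + card C' = card A + card B + card C" for A' B' C'
    proof -
      have fin: "finite A'" "finite B'"
        using low[OF that(1)] low[OF that(2)] finite_ground
        by (auto simp: low_def intro: finite_subset)
      from uncross[OF that(1,2)] show ?thesis
      proof
        assume "L (A' - B')"
        moreover have "card (A' - B') < card A'"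
          using shrink[of A' B'] fin that by blast
        moreover have "A' - B' \<union> B' \<union> C' = V"
          using that by blast
        ultimately show ?thesis
          using less.hyps[of "A' - B'" B' C'] that card by linarith
      next
        assume "L (B' - A')"
        moreover have "card (B' - A') < card B'"
          using shrink[of B' A'] fin that by blast
        moreover have "A' \<union> (B' - A') \<union> C' = V"
          using that by blast
        ultimately show ?thesis
          using less.hyps[of A' "B' - A'" C'] that card by linarith
      qed
    qed
    from False consider "A \<inter> B \<noteq> {}" | "A \<inter> C \<noteq> {}" | "B \<inter> C \<noteq> {}"
      by blast
    then show ?thesis
    proof cases
      case 1
      then show ?thesis using step[of A B C] less.prems by simp
    next
      case 2
      moreover have "A \<union> C \<union> B = V" using less.prems by blast
      ultimately show ?thesis using step[of A C B] less.prems by simp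
    next
      case 3
      moreover have "B \<union> C \<union> A = V" using less.prems by blast
      ultimately show ?thesis using step[of B C A] less.prems by simp
    qed
  qed
qed

text \<open>A maximal family that does not assemble \<open>V\<close> contains one side of every set of low value.
  Otherwise a minimal undecided set \<open>R\<close> could be added to it, so by maximality and rerooting
  \<open>V - R\<close> is assembled from the family; the same holds for a minimal undecided set \<open>Q\<close> contained
  in \<open>V - R\<close>. For \<open>Z\<close> of minimum value between \<open>R\<close> and \<open>V - Q\<close>, both \<open>Z\<close> and \<open>V - Z\<close> are
  obtained by shrinking these two assemblies, and joining them assembles \<open>V\<close>.\<close>

lemma decided_if_maximal:
  assumes low: "\<And>A. A \<in> F \<Longrightarrow> low k A"
    and closed: "\<And>A B. A \<in> F \<Longrightarrow> B \<subseteq> A \<Longrightarrow> low k B \<Longrightarrow> B \<in> F"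
    and empty: "{} \<in> F"
    and V: "\<not> assembled (low k) (\<lambda>A. A \<in> F) V"
    and maximal: "\<And>R. low k R \<Longrightarrow> R \<notin> F \<Longrightarrow> (\<And>B. B \<subset> R \<Longrightarrow> low k B \<Longrightarrow> B \<in> F) \<Longrightarrow>
        assembled (low k) (\<lambda>A. A \<in> F \<or> A = R) V"
    and S: "low k S"
  shows "S \<in> F \<or> V - S \<in> F"
proof (rule ccontr)
  let ?asm = "assembled (low k) (\<lambda>A. A \<in> F)"
  define undecided where "undecided R \<longleftrightarrow> low k R \<and> R \<notin> F \<and> V - R \<notin> F" for R
  have compl: "undecided (V - R)" if "undecided R" for R
    using that low_compl unfolding undecided_def by (auto simp: low_def double_diff)
  have ex: "\<exists>R. R \<subseteq> S \<and> undecided R \<and> ?asm (V - R)" if "undecided S" for S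
  proof -
    have "finite S"
      using that finite_ground by (auto simp: undecided_def low_def intro: finite_subset)
    then have "finite {R. R \<subseteq> S \<and> undecided R}"
      by simp
    moreover have "{R. R \<subseteq> S \<and> undecided R} \<noteq> {}"
      using that by blast
    ultimately obtain R where "R \<in> {R. R \<subseteq> S \<and> undecided R}"
      and "\<forall>R'\<in>{R. R \<subseteq> S \<and> undecided R}. R' \<le> R \<longrightarrow> R = R'"
      using finite_has_minimal[of "{R. R \<subseteq> S \<and> undecided R}"] by blast
    then have R: "R \<subseteq> S" "undecided R"
      and min: "\<And>R'. R' \<subseteq> S \<Longrightarrow> undecided R' \<Longrightarrow> R' \<subseteq> R \<Longrightarrow> R = R'"
      by blast+
    \<comment> \<open>A smaller low set is decided. It is not its complement that belongs to \<open>F\<close>, since then \<open>F\<close>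
      would contain the complement of \<open>R\<close>.\<close>
    have proper: "B \<in> F" if "B \<subset> R" "low k B" for B
    proof (rule ccontr)
      assume "B \<notin> F"
      have "V - B \<notin> F"
      proof
        assume "V - B \<in> F"
        moreover have "V - R \<subseteq> V - B" "low k (V - R)"
          using that R low_compl by (auto simp: undecided_def)
        ultimately have "V - R \<in> F"
          using closed by blast
        with R show False by (simp add: undecided_def)
      qed
      with \<open>B \<notin> F\<close> that have "undecided B" by (simp add: undecided_def)
      with min[of B] that R show False by auto
    qed
    have "assembled (low k) (\<lambda>A. A \<in> F \<or> A = R) V"
      using maximal[of R] proper R by (auto simp: undecided_def)
    from assembled_reroot[OF this] have "?asm (V - V) \<longrightarrow> ?asm (V - R)"
      using V R empty by (auto simp: undecided_def)
    moreover have "?asm {}"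
      using empty low by (intro assembled.leaf)
    ultimately show ?thesis
      using R by auto
  qed
  assume "\<not> ?thesis"
  then have "undecided S" using S by (simp add: undecided_def)
  from ex[OF this] obtain R where R: "undecided R" "?asm (V - R)" by blast
  from ex[OF compl[OF R(1)]] obtain Q where Q: "Q \<subseteq> V - R" "undecided Q" "?asm (V - Q)"
    by blast
  have RV: "R \<subseteq> V" "Q \<subseteq> V" "R \<subseteq> V - Q"
    using R Q by (auto simp: undecided_def low_def)
  \<comment> \<open>These bounds make \<open>Z\<close> fit into the assembled set \<open>V - Q\<close>, and its complement into the assembled
    set \<open>V - R\<close>.\<close>
  define between where "between = {Z. R \<subseteq> Z \<and> Z \<subseteq> V - Q}"
  have "finite between" "R \<in> between"
    using finite_ground RV by (auto simp: between_def intro: finite_subset[of _ "Pow V"])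
  then obtain Z where Z: "Z \<in> between" and min: "\<And>Z'. Z' \<in> between \<Longrightarrow> d Z \<le> d Z'"
    by (metis arg_min_if_finite(1) arg_min_least empty_iff)
  have "?asm Z"
  proof (rule assembled_shrink[OF Q(3)])
    show "d Z \<le> d Z'" if "Z \<subseteq> Z'" "Z' \<subseteq> V - Q" for Z'
      using min[of Z'] that Z by (auto simp: between_def)
  qed (use Z closed in \<open>auto simp: between_def\<close>)
  moreover have "?asm (V - Z)"
  proof (rule assembled_shrink[OF R(2)])
    show "d (V - Z) \<le> d Z'" if "V - Z \<subseteq> Z'" "Z' \<subseteq> V - R" for Z'
    proof -
      have "V - Z' \<in> between" "Z' \<subseteq> V" "Z \<subseteq> V"
        using that Z RV by (auto simp: between_def)
      then show ?thesis
        using min[of "V - Z'"] by (simp add: d_compl)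
    qed
  qed (use Z closed in \<open>auto simp: between_def\<close>)
  moreover have "Z \<union> (V - Z) = V"
    using Z by (auto simp: between_def)
  moreover have "low k V"
    using low_compl[OF low[OF empty]] by simp
  ultimately have "?asm V"
    using assembled.join[of "low k" "\<lambda>A. A \<in> F" Z "V - Z"] by simp
  with V show False ..
qed

text \<open>The family \<open>F\<close> consists of the small sides of the tangle. It extends \<open>L\<close>, which is how the
  tangle is forced to regard the given pieces as small.\<close>

lemma tangle_if_not_assembled:
  assumes low: "\<And>A. L A \<Longrightarrow> low k A"
    and closed: "\<And>A B. L A \<Longrightarrow> B \<subseteq> A \<Longrightarrow> low k B \<Longrightarrow> L B"
    and empty: "L {}"
    and V: "\<not> assembled (low k) L V"
  shows "\<exists>F. (\<forall>A. L A \<longrightarrow> A \<in> F) \<and> (\<forall>A\<in>F. low k A) \<and>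
    (\<forall>A. low k A \<longrightarrow> A \<in> F \<or> V - A \<in> F) \<and>
    (\<forall>A\<in>F. \<forall>B\<in>F. \<forall>C\<in>F. A \<union> B \<union> C \<noteq> V)"
proof -
  define \<F> where "\<F> = {F. Collect L \<subseteq> F \<and> F \<subseteq> Collect (low k) \<and>
      (\<forall>A\<in>F. \<forall>B. B \<subseteq> A \<and> low k B \<longrightarrow> B \<in> F) \<and> \<not> assembled (low k) (\<lambda>A. A \<in> F) V}"
  have "F \<subseteq> Pow V" if "F \<in> \<F>" for F
    using that by (auto simp: \<F>_def low_def dest!: subsetD)
  then have "\<F> \<subseteq> Pow (Pow V)"
    by blast
  then have "finite \<F>"
    using finite_ground by (meson finite_Pow_iff finite_subset)
  moreover have "Collect L \<in> \<F>"
    using low closed V by (auto simp: \<F>_def)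
  ultimately obtain F where F: "F \<in> \<F>" and max: "\<And>F'. F' \<in> \<F> \<Longrightarrow> F \<subseteq> F' \<Longrightarrow> F = F'"
    using finite_has_maximal[of \<F>] by blast
  have props: "\<And>A. L A \<Longrightarrow> A \<in> F" "\<And>A. A \<in> F \<Longrightarrow> low k A"
      "\<And>A B. A \<in> F \<Longrightarrow> B \<subseteq> A \<Longrightarrow> low k B \<Longrightarrow> B \<in> F"
      "\<not> assembled (low k) (\<lambda>A. A \<in> F) V"
    using F by (auto simp: \<F>_def)
  have "A \<in> F \<or> V - A \<in> F" if "low k A" for A
  proof (rule decided_if_maximal[OF props(2,3)])
    show "assembled (low k) (\<lambda>A. A \<in> F \<or> A = R) V"
      if "low k R" "R \<notin> F" "\<And>B. B \<subset> R \<Longrightarrow> low k B \<Longrightarrow> B \<in> F" for R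
    proof (rule ccontr)
      assume "\<not> ?thesis"
      then have "insert R F \<in> \<F>"
        using that props by (auto simp: \<F>_def disj_commute)
      from max[OF this] that show False by auto
    qed
  next
    show "\<not> assembled (low k) (\<lambda>A. A \<in> F) V" by (fact props(4))
  qed (use props(1) empty that in blast)+
  moreover have "A \<union> B \<union> C \<noteq> V" if "A \<in> F" "B \<in> F" "C \<in> F" for A B C
    using assembled_if_triple_cover[of "\<lambda>A. A \<in> F" k A B C] props that by blast
  ultimately show ?thesis
    using props(1,2) by (intro exI[of _ F]) simp
qed

end

section \<open>Components and trees\<close>

abbreviation linked :: "('v, 'e) mgraph \<Rightarrow> 'v \<Rightarrow> 'v \<Rightarrow> bool" where
  "linked G u v \<equiv> (u, v) \<in> (adjacency G)\<^sup>*"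

definition edge_closed :: "('v, 'e) mgraph \<Rightarrow> 'v set \<Rightarrow> bool" where
  "edge_closed G S \<longleftrightarrow> (\<forall>e\<in>edges G. ends G e \<inter> S \<noteq> {} \<longrightarrow> ends G e \<subseteq> S)"

lemma linked_edge: "e \<in> edges G \<Longrightarrow> ends G e = {u, v} \<Longrightarrow> linked G u v"
  by (auto simp: adjacency_def)

lemma linked_sym: "linked G u v \<Longrightarrow> linked G v u"
proof -
  have "sym (adjacency G)"
    by (auto simp: sym_def adjacency_def insert_commute)
  then show "linked G u v \<Longrightarrow> linked G v u"
    by (meson sym_rtrancl symD)
qed

lemma linked_edge_closed:
  assumes "linked G u v" "u \<in> S" "edge_closed G S"
  shows "v \<in> S"
  using assms by (induction rule: rtrancl_induct) (auto simp: adjacency_def edge_closed_def)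

lemma linked_restrict:
  assumes "linked G u v" "u \<in> S" "edge_closed G S"
    and "\<And>e. e \<in> edges G \<Longrightarrow> ends G e \<subseteq> S \<Longrightarrow> e \<in> edges H \<and> ends H e = ends G e"
  shows "linked H u v"
  using assms(1)
proof (induction rule: rtrancl_induct)
  case (step y z)
  obtain e where e: "e \<in> edges G" "ends G e = {y, z}"
    using step by (auto simp: adjacency_def)
  have "y \<in> S"
    using linked_edge_closed step assms by metis
  then have "ends G e \<subseteq> S"
    using assms(3) e by (auto simp: edge_closed_def)
  then have "linked H y z"
    using assms(4) e by (metis linked_edge)
  with step show ?case by (meson rtrancl_trans)
qed simp

lemma linked_mono:
  assumes "linked G u v" "edges G \<subseteq> edges H" "ends H = ends G"
  shows "linked H u v"
  using linked_restrict[OF assms(1), of UNIV H] assms by (auto simp: edge_closed_def)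

lemma multigraph_delete_vertex: "multigraph G \<Longrightarrow> multigraph (delete_vertex G v)"
  by (auto simp: multigraph_def delete_vertex_def)

lemma verts_delete [simp]:
  "verts (delete_vertex G v) = verts G - {v}" "verts (delete_edge G f) = verts G"
  by (auto simp: delete_vertex_def delete_edge_def)

lemma edges_delete [simp]:
  "edges (delete_vertex G v) = {e \<in> edges G. v \<notin> ends G e}"
  "edges (delete_edge G f) = edges G - {f}"
  by (auto simp: delete_vertex_def delete_edge_def)

lemma ends_delete [simp]:
  "ends (delete_vertex G v) = ends G" "ends (delete_edge G f) = ends G"
  by (auto simp: delete_vertex_def delete_edge_def)

lemma Union_components: "\<Union> (graph_components G) = verts G"
  by (auto simp: graph_components_def)

lemma component_nonempty: "C \<in> graph_components G \<Longrightarrow> C \<noteq> {}"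
  by (auto simp: graph_components_def)

lemma component_linked:
  assumes "C \<in> graph_components G" "u \<in> C" "v \<in> C"
  shows "linked G u v"
proof -
  obtain w where "linked G w u" "linked G w v"
    using assms by (auto simp: graph_components_def)
  then show ?thesis
    using linked_sym[of w u G] rtrancl_trans[of u w _ v] by blast
qed

lemma component_eq_if_linked:
  assumes "C \<in> graph_components G" "u \<in> C"
  shows "C = {v \<in> verts G. linked G u v}"
proof -
  obtain w where w: "C = {v \<in> verts G. linked G w v}" "linked G w u"
    using assms by (auto simp: graph_components_def)
  have "linked G w v \<longleftrightarrow> linked G u v" for v
    using w(2) linked_sym[of w u] rtrancl_trans[of w u _ v] rtrancl_trans[of u w _ v] by blast
  then show ?thesis using w(1) by simp
qed

lemma components_disjoint:
  "C \<in> graph_components G \<Longrightarrow> D \<in> graph_components G \<Longrightarrow> C \<noteq> D \<Longrightarrow> C \<inter> D = {}"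
proof (rule ccontr)
  assume CD: "C \<in> graph_components G" "D \<in> graph_components G" "C \<noteq> D" and "C \<inter> D \<noteq> {}"
  then obtain u where "u \<in> C" "u \<in> D" by auto
  with CD component_eq_if_linked[of C G u] component_eq_if_linked[of D G u] show False
    by simp
qed

lemma component_edge_closed:
  assumes "multigraph G" "C \<in> graph_components G"
  shows "edge_closed G C"
  unfolding edge_closed_def
proof (intro ballI impI subsetI)
  fix e x assume e: "e \<in> edges G" "ends G e \<inter> C \<noteq> {}" and x: "x \<in> ends G e"
  then obtain u where u: "u \<in> ends G e" "u \<in> C" by auto
  have "card (ends G e) = 1 \<or> card (ends G e) = 2"
    using assms(1) e by (simp add: multigraph_def)
  then have "x = u \<or> ends G e = {u, x}"
    using x u by (auto simp: card_2_iff card_1_singleton_iff)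
  then have "linked G u x"
    using e by (auto intro: linked_edge)
  moreover have "x \<in> verts G"
    using assms(1) e x by (auto simp: multigraph_def)
  ultimately show "x \<in> C"
    using component_eq_if_linked[OF assms(2) u(2)] by blast
qed

lemma componentI:
  assumes "S \<noteq> {}" "S \<subseteq> verts G" "edge_closed G S"
    and "\<And>u v. u \<in> S \<Longrightarrow> v \<in> S \<Longrightarrow> linked G u v"
  shows "S \<in> graph_components G"
proof -
  obtain u where u: "u \<in> S" using assms by auto
  then have "S \<subseteq> {v \<in> verts G. linked G u v}"
    using assms(2,4) by auto
  moreover have "{v \<in> verts G. linked G u v} \<subseteq> S"
    using linked_edge_closed[OF _ u assms(3)] by auto
  ultimately have "S = {v \<in> verts G. linked G u v}"
    by (rule equalityI)
  then show ?thesis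
    using u assms(2) by (auto simp: graph_components_def)
qed

lemma linked_subset_component:
  assumes "S \<noteq> {}" "S \<subseteq> verts G" "\<And>u v. u \<in> S \<Longrightarrow> v \<in> S \<Longrightarrow> linked G u v"
  obtains C where "C \<in> graph_components G" "S \<subseteq> C"
proof -
  obtain u where u: "u \<in> S" using assms by auto
  then have "S \<subseteq> {v \<in> verts G. linked G u v}"
    using assms by auto
  then show ?thesis
    using that u assms(2) by (auto simp: graph_components_def)
qed

lemma components_eq_pair:
  assumes "C \<in> graph_components G" "verts G - C \<in> graph_components G"
  shows "graph_components G = {C, verts G - C}"
proof -
  have "D = C \<or> D = verts G - C" if "D \<in> graph_components G" for D
    using that assms components_disjoint[of D G] component_nonempty[of D G] Union_components[of G]
    by blast
  then show ?thesis using assms by auto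
qed

text \<open>Walks are shortened to paths while they are built: if the new first vertex occurs already,
  everything before that occurrence is dropped.\<close>

lemma linked_imp_path:
  assumes "linked G a b"
  shows "\<exists>vs es. length vs = Suc (length es) \<and> distinct vs \<and> vs ! 0 = a \<and>
    vs ! length es = b \<and>
    (\<forall>i<length es. es ! i \<in> edges G \<and> ends G (es ! i) = {vs ! i, vs ! Suc i})"
  using assms
proof (induction rule: converse_rtrancl_induct)
  case base
  show ?case by (rule exI[of _ "[b]"], rule exI[of _ "[]"]) auto
next
  case (step a a')
  then obtain vs es e where p: "length vs = Suc (length es)" "distinct vs" "vs ! 0 = a'"
      "vs ! length es = b"
      "\<forall>i<length es. es ! i \<in> edges G \<and> ends G (es ! i) = {vs ! i, vs ! Suc i}"
    and e: "e \<in> edges G" "ends G e = {a, a'}"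
    by (auto simp: adjacency_def)
  show ?case
  proof (cases "a \<in> set vs")
    case True
    then obtain j where j: "j < length vs" "vs ! j = a"
      by (auto simp: in_set_conv_nth)
    show ?thesis
      by (rule exI[of _ "drop j vs"], rule exI[of _ "drop j es"]) (use p j in auto)
  next
    case False
    have "\<forall>i<length (e # es). (e # es) ! i \<in> edges G \<and>
        ends G ((e # es) ! i) = {(a # vs) ! i, (a # vs) ! Suc i}"
      using p e by (auto simp: nth_Cons split: nat.splits)
    then show ?thesis
      using p False by (intro exI[of _ "a # vs"] exI[of _ "e # es"]) auto
  qed
qed

text \<open>A path that avoids \<open>f\<close> and joins the ends of \<open>f\<close> would be closed by \<open>f\<close> to a cycle; if \<open>f\<close> is a
  loop, this is the cycle of length 1.\<close>

lemma tree_edge_bridge: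
  assumes T: "is_tree T" and f: "f \<in> edges T" "ends T f = {a, b}"
  shows "\<not> linked (delete_edge T f) a b"
proof
  assume "linked (delete_edge T f) a b"
  from linked_imp_path[OF this] obtain vs es where p:
    "length vs = Suc (length es)" "distinct vs" "vs ! 0 = a" "vs ! length es = b"
    "\<And>i. i < length es \<Longrightarrow> es ! i \<in> edges T - {f} \<and> ends T (es ! i) = {vs ! i, vs ! Suc i}"
    by auto
  have "es ! i \<noteq> es ! j" if "i < j" "j < length es" for i j
  proof
    assume "es ! i = es ! j"
    then have "vs ! i = vs ! j \<or> vs ! i = vs ! Suc j"
      using p(5)[of i] p(5)[of j] that by auto
    then show False
      using that p(1,2) by (auto simp: nth_eq_iff_index_eq)
  qed
  then have "distinct es"
    unfolding distinct_conv_nth by (metis nat_neq_iff)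
  moreover have "f \<notin> set es" "set es \<subseteq> edges T"
    using p(5) by (auto simp: in_set_conv_nth)
  moreover have "ends T ((es @ [f]) ! i) = {vs ! i, vs ! (Suc i mod length vs)}"
    if "i < length vs" for i
    using that p f by (cases "i = length es") (auto simp: nth_append insert_commute)
  ultimately have "is_cycle T vs (es @ [f])"
    using p f unfolding is_cycle_def by auto
  with T show False by (auto simp: is_tree_def)
qed

lemma exists_edge_to_component:
  assumes T: "is_tree T" and t: "t \<in> verts T"
    and C: "C \<in> graph_components (delete_vertex T t)"
  obtains f t' where "f \<in> edges T" "ends T f = {t, t'}" "t' \<in> C"
proof -
  have mg: "multigraph T" using T by (simp add: is_tree_def)
  have CT: "C \<subseteq> verts T - {t}"
    using C Union_components[of "delete_vertex T t"] by auto
  have "\<not> edge_closed T (- C)"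
  proof
    assume cl: "edge_closed T (- C)"
    obtain c where c: "c \<in> C" using component_nonempty[OF C] by auto
    then have "linked T t c"
      using T t CT by (auto simp: is_tree_def graph_connected_def)
    with linked_edge_closed[OF this _ cl] c CT show False by auto
  qed
  then obtain f where f: "f \<in> edges T" "ends T f \<inter> C \<noteq> {}" "\<not> ends T f \<subseteq> C"
    by (auto simp: edge_closed_def)
  have "t \<in> ends T f"
    using component_edge_closed[OF multigraph_delete_vertex[OF mg] C] f
    by (auto simp: edge_closed_def)
  moreover obtain t' where "t' \<in> ends T f" "t' \<in> C" using f by auto
  moreover from this have "t \<noteq> t'" using CT by auto
  moreover have "card (ends T f) = 1 \<or> card (ends T f) = 2"
    using mg f by (simp add: multigraph_def)
  ultimately have "ends T f = {t, t'}"
    by (auto simp: card_2_iff card_1_singleton_iff)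
  then show ?thesis using that f \<open>t' \<in> C\<close> by blast
qed

text \<open>Every edge of a tree is a bridge, so only one edge \<open>f\<close> joins \<open>t\<close> to the component \<open>C\<close>. Seen
  from its other end, \<open>f\<close> separates \<open>C\<close> from the rest of the tree. This is what makes
  inductions over components of vertex-deleted trees work.\<close>

lemma tree_component_edge:
  assumes T: "is_tree T" and t: "t \<in> verts T"
    and C: "C \<in> graph_components (delete_vertex T t)"
  obtains f t' where "f \<in> edges T" "ends T f = {t, t'}" "t' \<in> C"
    "graph_components (delete_edge T f) = {C, verts T - C}"
    "verts T - C \<in> graph_components (delete_vertex T t')"
proof -
  have mg: "multigraph T" using T by (simp add: is_tree_def)
  have CT: "C \<subseteq> verts T - {t}"
    using C Union_components[of "delete_vertex T t"] by auto
  obtain f t' where f: "f \<in> edges T" "ends T f = {t, t'}" and t': "t' \<in> C"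
    using exists_edge_to_component[OF assms] .
  have keep: "edges (delete_vertex T t) \<subseteq> edges (delete_edge T f)"
    using f by auto
  have unique: "e = f" if e: "e \<in> edges T" "ends T e \<inter> C \<noteq> {}" "\<not> ends T e \<subseteq> C" for e
  proof (rule ccontr)
    assume "e \<noteq> f"
    have "t \<in> ends T e"
      using component_edge_closed[OF multigraph_delete_vertex[OF mg] C] e
      by (auto simp: edge_closed_def)
    moreover obtain c where c: "c \<in> ends T e" "c \<in> C" using e by auto
    moreover have "c \<noteq> t" using c CT by auto
    moreover have "card (ends T e) = 1 \<or> card (ends T e) = 2"
      using mg e by (simp add: multigraph_def)
    ultimately have "ends T e = {t, c}"
      by (auto simp: card_2_iff card_1_singleton_iff)
    then have "linked (delete_edge T f) t c"
      using e \<open>e \<noteq> f\<close> by (intro linked_edge[of e]) auto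
    moreover have "linked (delete_edge T f) c t'"
      using component_linked[OF C c(2) t'] keep by (rule linked_mono) simp
    ultimately have "linked (delete_edge T f) t t'"
      by (rule rtrancl_trans)
    with tree_edge_bridge[OF T f] show False ..
  qed
  have closed: "edge_closed (delete_edge T f) C" "edge_closed (delete_edge T f) (verts T - C)"
    using unique mg by (auto simp: edge_closed_def multigraph_def)+
  have "C \<in> graph_components (delete_edge T f)"
  proof (rule componentI)
    show "linked (delete_edge T f) u v" if "u \<in> C" "v \<in> C" for u v
      using component_linked[OF C that] keep by (rule linked_mono) simp
  qed (use CT t' closed in auto)
  moreover have to_t: "linked (delete_edge T f) u t" if u: "u \<in> verts T - C" for u
  proof (cases "u = t")
    case False
    then obtain D where D: "D \<in> graph_components (delete_vertex T t)" "u \<in> D"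
      using u Union_components[of "delete_vertex T t"] by auto
    from exists_edge_to_component[OF T t D(1)] obtain g u' where
      g: "g \<in> edges T" "ends T g = {t, u'}" "u' \<in> D" .
    have "D \<noteq> C" using D u by auto
    then have "t' \<notin> D" "t' \<noteq> t"
      using components_disjoint[OF D(1) C] t' CT by auto
    then have "g \<noteq> f"
      using f g by (auto simp: doubleton_eq_iff)
    then have "linked (delete_edge T f) t u'"
      using g by (intro linked_edge[of g]) auto
    moreover have "linked (delete_edge T f) u' u"
      using component_linked[OF D(1) g(3) D(2)] keep by (rule linked_mono) simp
    ultimately show ?thesis
      by (meson linked_sym rtrancl_trans)
  qed simp
  have rest: "linked (delete_edge T f) u v" if "u \<in> verts T - C" "v \<in> verts T - C" for u v
    using to_t that by (meson linked_sym rtrancl_trans)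
  then have "verts T - C \<in> graph_components (delete_edge T f)"
    using t CT closed by (intro componentI) auto
  ultimately have "graph_components (delete_edge T f) = {C, verts T - C}"
    using components_eq_pair[of C "delete_edge T f"] by simp
  moreover have "verts T - C \<in> graph_components (delete_vertex T t')"
  proof (rule componentI)
    show "edge_closed (delete_vertex T t') (verts T - C)"
      unfolding edge_closed_def
    proof (intro ballI impI)
      fix e assume e: "e \<in> edges (delete_vertex T t')"
        and "ends (delete_vertex T t') e \<inter> (verts T - C) \<noteq> {}"
      moreover have "e \<noteq> f" using e f by auto
      ultimately show "ends (delete_vertex T t') e \<subseteq> verts T - C"
        using unique[of e] mg by (auto simp: multigraph_def)
    qed
    show "linked (delete_vertex T t') u v" if "u \<in> verts T - C" "v \<in> verts T - C" for u v
      using rest[OF that] that(1) closed(2) by (rule linked_restrict) (use t' in auto)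
  qed (use t t' CT in auto)
  ultimately show ?thesis
    using that f t' by blast
qed

text \<open>The edges from \<open>t\<close> into different components are different.\<close>

lemma card_components_le_incident:
  assumes T: "is_tree T" and t: "t \<in> verts T"
  shows "card (graph_components (delete_vertex T t)) \<le> card {e \<in> edges T. t \<in> ends T e}"
proof -
  let ?C = "graph_components (delete_vertex T t)"
  have "\<forall>C\<in>?C. \<exists>f. f \<in> edges T \<and> (\<exists>t'\<in>C. ends T f = {t, t'})"
    using exists_edge_to_component[OF T t] by metis
  then obtain g where g: "\<And>C. C \<in> ?C \<Longrightarrow> g C \<in> edges T \<and> (\<exists>t'\<in>C. ends T (g C) = {t, t'})"
    by metis
  have "inj_on g ?C"
  proof (rule inj_onI)
    fix C D assume CD: "C \<in> ?C" "D \<in> ?C" "g C = g D"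
    obtain c d where "c \<in> C" "d \<in> D" "{t, c} = {t, d}"
      using g[OF CD(1)] g[OF CD(2)] CD(3) by auto
    then have "C \<inter> D \<noteq> {}"
      by (auto simp: doubleton_eq_iff)
    then show "C = D"
      using components_disjoint CD by blast
  qed
  moreover have "g ` ?C \<subseteq> {e \<in> edges T. t \<in> ends T e}"
    using g by auto
  moreover have "finite {e \<in> edges T. t \<in> ends T e}"
    using T by (auto simp: is_tree_def multigraph_def)
  ultimately show ?thesis
    by (metis card_image card_mono)
qed

section \<open>Cuts of a multigraph\<close>

definition crossing :: "('v, 'e) mgraph \<Rightarrow> 'v set \<Rightarrow> 'e set" where
  "crossing G A = {e \<in> edges G. ends G e \<inter> A \<noteq> {} \<and> \<not> ends G e \<subseteq> A}"

definition cut_size :: "('v, 'e) mgraph \<Rightarrow> 'v set \<Rightarrow> nat" where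
  "cut_size G A = card (crossing G A)"

text \<open>The inequality holds for the contribution of each single edge.\<close>

lemma (in multigraph) cut_size_submodular:
  "cut_size G (A \<inter> B) + cut_size G (A \<union> B) \<le> cut_size G A + cut_size G B"
proof -
  have as_sum: "cut_size G S = (\<Sum>e\<in>edges G. of_bool (ends G e \<inter> S \<noteq> {} \<and> \<not> ends G e \<subseteq> S))" for S
    using finite_edges by (simp add: cut_size_def crossing_def sum_of_bool_eq Int_def)
  show ?thesis
    unfolding as_sum sum.distrib[symmetric] by (rule sum_mono) auto
qed

sublocale multigraph \<subseteq> connectivity_function "verts G" "cut_size G"
proof
  show "cut_size G (verts G - A) = cut_size G A" if "A \<subseteq> verts G" for A
  proof -
    have "crossing G (verts G - A) = crossing G A"
      using ends_in_verts that by (fastforce simp: crossing_def)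
    then show ?thesis by (simp add: cut_size_def)
  qed
qed (use finite_verts cut_size_submodular in auto)

context multigraph
begin

lemma ends_nonempty: "e \<in> edges G \<Longrightarrow> ends G e \<noteq> {}"
  using card_ends by fastforce

lemma finite_crossing [simp]: "finite (crossing G A)"
  using finite_edges by (simp add: crossing_def)

lemma edges_between_compl:
  assumes "A \<subseteq> verts G"
  shows "edges_between G A (verts G - A) = crossing G A"
proof -
  have "(\<exists>a\<in>A. \<exists>b\<in>verts G - A. ends G e = {a, b}) \<longleftrightarrow> ends G e \<inter> A \<noteq> {} \<and> \<not> ends G e \<subseteq> A"
    if e: "e \<in> edges G" for e
  proof
    assume "ends G e \<inter> A \<noteq> {} \<and> \<not> ends G e \<subseteq> A"
    then obtain a b where ab: "a \<in> ends G e" "a \<in> A" "b \<in> ends G e" "b \<notin> A" by auto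
    then have "ends G e = {a, b}"
      using card_ends[OF e] by (auto simp: card_1_singleton_iff card_2_iff)
    moreover have "b \<in> verts G" using ab ends_in_verts[OF e] by auto
    ultimately show "\<exists>a\<in>A. \<exists>b\<in>verts G - A. ends G e = {a, b}" using ab by auto
  qed auto
  then show ?thesis
    by (auto simp: edges_between_def crossing_def)
qed

lemma edges_between_compl':
  assumes "A \<subseteq> verts G"
  shows "edges_between G (verts G - A) A = crossing G A"
proof -
  have "edges_between G (verts G - A) A = edges_between G A (verts G - A)"
    by (auto simp: edges_between_def insert_commute)
  with edges_between_compl[OF assms] show ?thesis by simp
qed

lemma edge_cut_low_iff:
  "edge_cut G A B \<and> cut_order G A B < k \<longleftrightarrow> low k A \<and> B = verts G - A"
proof -
  have "edge_cut G A B \<longleftrightarrow> A \<subseteq> verts G \<and> B = verts G - A"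
    by (auto simp: edge_cut_def)
  then show ?thesis
    using edges_between_compl[of A] by (auto simp: cut_order_def low_def cut_size_def)
qed

end

section \<open>Torsos of a tree-cut decomposition\<close>

locale tree_cut = multigraph G for G :: "('v, 'e) mgraph" +
  fixes T :: "('t, 'f) mgraph" and X :: "'t \<Rightarrow> 'v set"
  assumes decomposition: "tree_cut_decomposition G T X"
begin

abbreviation branches :: "'t \<Rightarrow> 't set set" where
  "branches t \<equiv> graph_components (delete_vertex T t)"

lemma tree: "is_tree T"
  using decomposition by (simp add: tree_cut_decomposition_def)

lemma finite_nodes: "finite (verts T)"
  using tree by (simp add: is_tree_def multigraph_def)

lemma branch_subset: "C \<in> branches t \<Longrightarrow> C \<subseteq> verts T - {t}"
  using Union_components[of "delete_vertex T t"] by auto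

lemma finite_branches: "finite (branches t)"
proof (rule finite_subset)
  show "branches t \<subseteq> Pow (verts T)" using branch_subset by blast
qed (simp add: finite_nodes)

lemma bag_subset: "S \<subseteq> verts T \<Longrightarrow> bag_union X S \<subseteq> verts G"
  using decomposition by (auto simp: tree_cut_decomposition_def bag_union_def)

lemma bag_disjoint:
  "S \<subseteq> verts T \<Longrightarrow> S' \<subseteq> verts T \<Longrightarrow> S \<inter> S' = {} \<Longrightarrow> bag_union X S \<inter> bag_union X S' = {}"
  using decomposition
  by (fastforce simp: tree_cut_decomposition_def bag_union_def disjoint_family_on_def)

lemma bag_compl:
  assumes "S \<subseteq> verts T"
  shows "bag_union X (verts T - S) = verts G - bag_union X S"
proof -
  have "bag_union X (verts T - S) \<union> bag_union X S = bag_union X (verts T)"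
    using assms by (simp add: bag_union_def Un_absorb2 flip: UN_Un)
  then have "bag_union X (verts T - S) \<union> bag_union X S = verts G"
    using decomposition by (simp add: tree_cut_decomposition_def bag_union_def)
  then show ?thesis
    using bag_disjoint[of S "verts T - S"] assms by auto
qed

lemma bag_singleton: "bag_union X {t} = X t"
  by (simp add: bag_union_def)

lemma branch_bags_disjoint:
  assumes "C \<in> branches t" "D \<in> branches t" "C \<noteq> D"
  shows "bag_union X C \<inter> bag_union X D = {}"
  using bag_disjoint[of C D] components_disjoint[OF assms] branch_subset assms by blast

lemma bag_branch_disjoint:
  assumes "t \<in> verts T" "C \<in> branches t"
  shows "X t \<inter> bag_union X C = {}"
  using bag_disjoint[of "{t}" C] branch_subset assms bag_singleton[of t] by auto

lemma Union_branch_bags: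
  assumes "t \<in> verts T"
  shows "X t \<union> \<Union> (bag_union X ` branches t) = verts G"
proof -
  have "\<Union> (bag_union X ` branches t) = bag_union X (\<Union> (branches t))"
    by (auto simp: bag_union_def)
  also have "\<dots> = verts G - X t"
    using bag_compl[of "{t}"] assms by (simp add: Union_components bag_singleton)
  finally show ?thesis
    using bag_subset[of "{t}"] assms by (auto simp: bag_singleton)
qed

text \<open>The edges deleted in the torso are those that become loops at an identified vertex.\<close>

lemma edges_torso:
  assumes t: "t \<in> verts T"
  shows "edges (torso G T X t) = {e \<in> edges G. \<forall>C\<in>branches t. \<not> ends G e \<subseteq> bag_union X C}"
proof -
  have "torso_ends G T X t e = {Inr C} \<longleftrightarrow> ends G e \<subseteq> bag_union X C"
    if e: "e \<in> edges G" and C: "C \<in> branches t" for e C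
  proof
    assume eq: "torso_ends G T X t e = {Inr C}"
    show "ends G e \<subseteq> bag_union X C"
    proof
      fix x assume x: "x \<in> ends G e"
      have "x \<notin> X t"
        using eq x by (auto simp: torso_ends_def)
      then obtain D where D: "D \<in> branches t" "x \<in> bag_union X D"
        using Union_branch_bags[OF t] ends_in_verts[OF e] x by blast
      then have "Inr D \<in> torso_ends G T X t e"
        using x by (auto simp: torso_ends_def)
      with eq D show "x \<in> bag_union X C" by auto
    qed
  next
    assume sub: "ends G e \<subseteq> bag_union X C"
    have "ends G e \<inter> X t = {}"
      using sub bag_branch_disjoint[OF t C] by blast
    moreover have "{D \<in> branches t. ends G e \<inter> bag_union X D \<noteq> {}} = {C}"
      using sub ends_nonempty[OF e] branch_bags_disjoint[OF C] C by blast
    ultimately show "torso_ends G T X t e = {Inr C}"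
      by (simp add: torso_ends_def)
  qed
  then show ?thesis by (auto simp: torso_def)
qed

lemma finite_edges_torso: "finite (edges (torso G T X t))"
  using finite_edges by (simp add: torso_def)

lemma torso_width_le_iff:
  "torso_width G T X \<le> w \<longleftrightarrow> (\<forall>t\<in>verts T. card (edges (torso G T X t)) \<le> w)"
proof -
  let ?bound = "\<lambda>w. \<forall>t\<in>verts T. card (edges (torso G T X t)) \<le> w"
  have "?bound (card (edges G))"
    using finite_edges by (auto simp: torso_def intro!: card_mono)
  from LeastI[of ?bound, OF this] have "?bound (torso_width G T X)"
    by (simp add: torso_width_def)
  moreover have "torso_width G T X \<le> w" if "?bound w"
    unfolding torso_width_def using that by (rule Least_le)
  ultimately show ?thesis by (meson order_trans)
qed

text \<open>The vertex sets that become the vertices of the torso at \<open>t\<close>.\<close>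

definition torso_parts :: "'t \<Rightarrow> 'v set set" where
  "torso_parts t = bag_union X ` branches t \<union> (\<lambda>v. {v}) ` X t"

lemma finite_torso_parts:
  assumes "t \<in> verts T"
  shows "finite (torso_parts t)"
  using finite_branches bag_subset[of "{t}"] finite_verts assms
  by (auto simp: torso_parts_def bag_singleton intro: finite_subset)

lemma torso_parts_disjoint:
  assumes t: "t \<in> verts T" and AB: "A \<in> torso_parts t" "B \<in> torso_parts t" "A \<noteq> B"
  shows "A \<inter> B = {}"
proof -
  have "{v} \<inter> bag_union X C = {}" if "v \<in> X t" "C \<in> branches t" for v C
    using bag_branch_disjoint[OF t that(2)] that by blast
  then show ?thesis
    using AB branch_bags_disjoint unfolding torso_parts_def by blast
qed

lemma Union_torso_parts: "t \<in> verts T \<Longrightarrow> \<Union> (torso_parts t) = verts G"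
  using Union_branch_bags by (auto simp: torso_parts_def)

text \<open>An edge that crosses a union of parts is not a loop at an identified vertex, and so
  belongs to the torso.\<close>

lemma cut_size_torso_parts:
  assumes t: "t \<in> verts T" and F: "F \<subseteq> torso_parts t"
  shows "cut_size G (\<Union>F) \<le> card (edges (torso G T X t))"
proof -
  have "\<not> ends G e \<subseteq> bag_union X C" if e: "e \<in> crossing G (\<Union>F)" and C: "C \<in> branches t" for e C
  proof
    assume sub: "ends G e \<subseteq> bag_union X C"
    obtain A where A: "A \<in> F" "ends G e \<inter> A \<noteq> {}"
      using e by (auto simp: crossing_def)
    have "bag_union X C \<in> torso_parts t"
      using C by (auto simp: torso_parts_def)
    then have "A = bag_union X C"
      using torso_parts_disjoint[OF t, of A "bag_union X C"] A F sub by blast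
    then show False
      using e A sub by (auto simp: crossing_def)
  qed
  then have "crossing G (\<Union>F) \<subseteq> edges (torso G T X t)"
    using edges_torso[OF t] by (auto simp: crossing_def)
  then show ?thesis
    unfolding cut_size_def using finite_edges_torso by (rule card_mono[rotated])
qed

lemma low_torso_parts:
  assumes "t \<in> verts T" "F \<subseteq> torso_parts t" "card (edges (torso G T X t)) < k"
  shows "low k (\<Union>F)"
  using cut_size_torso_parts[OF assms(1,2)] Union_torso_parts[OF assms(1)] assms
  by (auto simp: low_def)

section \<open>Small torsos exclude edge-tangles\<close>

text \<open>Any union of torso parts has few crossing edges, so the tangle decides on it. Some node
  has all its branches on the small side: start from a branch that is not small, as small as
  possible, and move to the end of the edge that leads into it. The union of the branches at
  this node is then small, although few edges meet its complement, the bag of the node.\<close>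

lemma no_edge_tangle:
  assumes width: "\<And>t. t \<in> verts T \<Longrightarrow> card (edges (torso G T X t)) < k"
  shows "\<not> edge_tangle G k \<E>"
proof
  assume "edge_tangle G k \<E>"
  then have decided: "\<And>A. low k A \<Longrightarrow> (A, verts G - A) \<in> \<E> \<or> (verts G - A, A) \<in> \<E>"
    and triple: "\<And>A1 B1 A2 B2 A3 B3. (A1, B1) \<in> \<E> \<Longrightarrow> (A2, B2) \<in> \<E> \<Longrightarrow> (A3, B3) \<in> \<E> \<Longrightarrow>
        B1 \<inter> B2 \<inter> B3 \<noteq> {}"
    and many: "\<And>A B. (A, B) \<in> \<E> \<Longrightarrow> k \<le> card (incident_edges G B)"
    unfolding edge_tangle_def edge_cut_low_iff by blast+
  define small where "small A \<longleftrightarrow> A \<subseteq> verts G \<and> (A, verts G - A) \<in> \<E>" for A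
  have small_empty: "small {}" if "low k {}"
    using decided[OF that] triple[of "verts G" "{}" "verts G" "{}" "verts G" "{}"]
    by (auto simp: small_def)
  \<comment> \<open>Were the union the large side of its cut, it would be disjoint from the intersection of the large
    sides belonging to \<open>A\<close> and \<open>B\<close>, against the axiom on triples of cuts.\<close>
  have small_Un: "small (A \<union> B)" if "small A" "small B" "low k (A \<union> B)" for A B
    using decided[OF that(3)] that
      triple[of A "verts G - A" B "verts G - B" "verts G - (A \<union> B)" "A \<union> B"]
    by (auto simp: small_def)
  have low_branch: "low k (bag_union X C)" if "t \<in> verts T" "C \<in> branches t" for t C
    using low_torso_parts[of t "{bag_union X C}" k] width that by (auto simp: torso_parts_def)
  have "\<exists>t\<in>verts T. \<forall>C\<in>branches t. small (bag_union X C)"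
  proof (rule ccontr)
    assume no_sink: "\<not> ?thesis"
    define big where "big C \<longleftrightarrow> (\<exists>t\<in>verts T. C \<in> branches t \<and> \<not> small (bag_union X C))" for C
    obtain t0 where "t0 \<in> verts T"
      using tree by (auto simp: is_tree_def graph_connected_def)
    then have "\<exists>C. big C"
      using no_sink unfolding big_def by blast
    then obtain C where "big C" and min: "\<And>D. big D \<Longrightarrow> card C \<le> card D"
      using ex_has_least_nat[of big _ card] by blast
    then obtain t where t: "t \<in> verts T" "C \<in> branches t" "\<not> small (bag_union X C)"
      by (auto simp: big_def)
    from tree_component_edge[OF tree t(1,2)] obtain t' where t': "t' \<in> C"
      "verts T - C \<in> branches t'" by metis
    have CT: "C \<subseteq> verts T" using branch_subset[OF t(2)] by auto
    have "small (bag_union X D)" if D: "D \<in> branches t'" for D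
    proof (cases "D = verts T - C")
      case True
      have "(verts G - bag_union X C, bag_union X C) \<in> \<E>"
        using t decided[OF low_branch[OF t(1,2)]] bag_subset[OF CT] by (auto simp: small_def)
      moreover have "verts G - (verts G - bag_union X C) = bag_union X C"
        using bag_subset[OF CT] by auto
      ultimately show ?thesis
        using True bag_compl[OF CT] by (simp add: small_def)
    next
      case False
      then have "D \<subset> C"
        using components_disjoint[OF D t'(2)] branch_subset[OF D] t'(1) by blast
      then have "card D < card C"
        using CT finite_nodes by (meson finite_subset psubset_card_mono)
      then have "\<not> big D" using min by (meson not_le)
      then show ?thesis using D t' CT by (auto simp: big_def)
    qed
    with no_sink t' CT show False by blast
  qed
  then obtain t where t: "t \<in> verts T" and sink: "\<And>C. C \<in> branches t \<Longrightarrow> small (bag_union X C)"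
    by auto
  have lowF: "low k (\<Union>F)" if "F \<subseteq> bag_union X ` branches t" for F
    using that t width by (intro low_torso_parts[of t]) (auto simp: torso_parts_def)
  have "small (\<Union>F)" if "finite F" "F \<subseteq> bag_union X ` branches t" for F
    using that
  proof (induction rule: finite_induct)
    case empty
    then show ?case using small_empty lowF[of "{}"] by simp
  next
    case (insert A F)
    then show ?case using small_Un[of A "\<Union>F"] sink lowF[of "insert A F"] by auto
  qed
  then have "small (\<Union> (bag_union X ` branches t))"
    using finite_branches by blast
  moreover have "verts G - \<Union> (bag_union X ` branches t) = X t"
    using Union_branch_bags[OF t] bag_branch_disjoint[OF t] by blast
  ultimately have "k \<le> card (incident_edges G (X t))"
    using many by (auto simp: small_def)
  also have "\<dots> \<le> card (edges (torso G T X t))"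
  proof (rule card_mono[OF finite_edges_torso])
    show "incident_edges G (X t) \<subseteq> edges (torso G T X t)"
      using bag_branch_disjoint[OF t] by (fastforce simp: incident_edges_def edges_torso[OF t])
  qed
  finally show False using width[OF t] by simp
qed

end

section \<open>Assembling the vertex set along a tree-cut decomposition\<close>

abbreviation is_singleton_set :: "'a set \<Rightarrow> bool" where
  "is_singleton_set S \<equiv> \<exists>v. S = {v}"

context tree_cut
begin

text \<open>Induction on the size of the branch: seen from the end in \<open>C\<close> of the edge joining \<open>t\<close> to
  \<open>C\<close>, one branch is the complement of \<open>C\<close> and all others are properly contained in \<open>C\<close>. The
  parts of the torso at that end other than the complement of \<open>C\<close> can be joined one by one in any
  order.\<close>

lemma assembled_branch:
  assumes width: "\<And>t. t \<in> verts T \<Longrightarrow> card (edges (torso G T X t)) < k"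
    and "t \<in> verts T" "C \<in> branches t"
  shows "bag_union X C = {} \<or> assembled (low k) is_singleton_set (bag_union X C)"
  using assms(2,3)
proof (induction "card C" arbitrary: t C rule: less_induct)
  case less
  have CT: "C \<subseteq> verts T" using branch_subset[OF less.prems(2)] by auto
  from tree_component_edge[OF tree less.prems] obtain t' where t': "t' \<in> C"
    and co: "verts T - C \<in> branches t'" by metis
  have t'T: "t' \<in> verts T" using t' CT by auto
  define F where "F = bag_union X ` (branches t' - {verts T - C}) \<union> (\<lambda>v. {v}) ` X t'"
  have F: "F \<subseteq> torso_parts t'" by (auto simp: F_def torso_parts_def)
  have "\<Union>F = bag_union X C"
  proof -
    have D: "bag_union X D \<subseteq> bag_union X C" if "D \<in> branches t'" "D \<noteq> verts T - C" for D
      using components_disjoint[OF that(1) co that(2)] branch_subset[OF that(1)]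
      by (auto simp: bag_union_def)
    moreover have "X t' \<subseteq> bag_union X C"
      using t' by (auto simp: bag_union_def)
    ultimately have "\<Union>F \<subseteq> bag_union X C"
      by (auto simp: F_def)
    moreover have "bag_union X C \<subseteq> \<Union>F"
    proof
      fix x assume x: "x \<in> bag_union X C"
      then have "x \<notin> bag_union X (verts T - C)" "x \<in> verts G"
        using bag_compl[OF CT] bag_subset[OF CT] by auto
      then show "x \<in> \<Union>F"
        using Union_branch_bags[OF t'T] by (auto simp: F_def)
    qed
    ultimately show ?thesis by simp
  qed
  moreover have "\<Union>F = {} \<or> assembled (low k) is_singleton_set (\<Union>F)"
  proof (rule assembled_Union)
    show "finite F"
      using F finite_torso_parts[OF t'T] by (rule finite_subset)
    show "A \<inter> B = {}" if "A \<in> F" "B \<in> F" "A \<noteq> B" for A B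
      using torso_parts_disjoint[OF t'T] F that by blast
    show low: "low k (\<Union>F')" if "F' \<subseteq> F" for F'
      using low_torso_parts[OF t'T] width[OF t'T] F that by blast
    show "A = {} \<or> assembled (low k) is_singleton_set A" if A: "A \<in> F" for A
    proof -
      consider D where "D \<in> branches t'" "D \<noteq> verts T - C" "A = bag_union X D"
        | v where "A = {v}"
        using A by (auto simp: F_def)
      then show ?thesis
      proof cases
        case 1
        then have "D \<subset> C"
          using components_disjoint[OF 1(1) co] branch_subset[OF 1(1)] t' by blast
        then have "card D < card C"
          using CT finite_nodes by (meson finite_subset psubset_card_mono)
        then show ?thesis
          using less.hyps t'T 1 by blast
      next
        case 2
        then show ?thesis
          using low[of "{A}"] A by (auto intro: assembled.leaf)
      qed
    qed
  qed
  ultimately show ?case by simp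
qed

text \<open>One vertex is left out because the root of the binary tree would otherwise have degree 2; the
  leaf for the missing vertex raises its degree to 3.\<close>

lemma assembled_delete_vertex:
  assumes width: "\<And>t. t \<in> verts T \<Longrightarrow> card (edges (torso G T X t)) < k"
    and v: "v \<in> verts G" and two: "2 \<le> card (verts G)"
  shows "assembled (low k) is_singleton_set (verts G - {v})"
proof -
  obtain t where t: "t \<in> verts T" "v \<in> X t"
    using v decomposition by (auto simp: tree_cut_decomposition_def)
  define F where "F = torso_parts t - {{v}}"
  have part: "{v} \<in> torso_parts t"
    using t by (auto simp: torso_parts_def)
  have "\<Union>F = verts G - {v}"
  proof -
    have "v \<notin> A" if "A \<in> F" for A
      using torso_parts_disjoint[OF t(1) _ part] that by (auto simp: F_def)
    then show ?thesis
      using Union_torso_parts[OF t(1)] by (auto simp: F_def)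
  qed
  moreover have "\<Union>F = {} \<or> assembled (low k) is_singleton_set (\<Union>F)"
  proof (rule assembled_Union)
    show "finite F"
      using finite_torso_parts[OF t(1)] by (simp add: F_def)
    show "A \<inter> B = {}" if "A \<in> F" "B \<in> F" "A \<noteq> B" for A B
      using torso_parts_disjoint[OF t(1)] that by (auto simp: F_def)
    show low: "low k (\<Union>F')" if "F' \<subseteq> F" for F'
      using low_torso_parts[OF t(1)] width[OF t(1)] that by (auto simp: F_def)
    show "A = {} \<or> assembled (low k) is_singleton_set A" if A: "A \<in> F" for A
    proof (cases "A \<in> bag_union X ` branches t")
      case True
      then show ?thesis using assembled_branch[OF width t(1)] by auto
    next
      case False
      then have "is_singleton_set A"
        using A by (auto simp: F_def torso_parts_def)
      then show ?thesis
        using low[of "{A}"] A by (auto intro: assembled.leaf)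
    qed
  qed
  moreover have "verts G - {v} \<noteq> {}"
  proof
    assume "verts G - {v} = {}"
    then have "verts G \<subseteq> {v}" by auto
    then have "card (verts G) \<le> 1"
      using card_mono[of "{v}" "verts G"] by simp
    with two show False by simp
  qed
  ultimately show ?thesis by simp
qed

section \<open>Torsos of carvings\<close>

lemma cut_size_branch_le_adhesion:
  assumes t: "t \<in> verts T" and C: "C \<in> branches t"
  shows "cut_size G (bag_union X C) \<le> adhesion G T X"
proof -
  have CT: "C \<subseteq> verts T" "t \<notin> C" using branch_subset[OF C] by auto
  obtain f where f: "f \<in> edges T" "graph_components (delete_edge T f) = {C, verts T - C}"
    using tree_component_edge[OF tree t C] by metis
  have "crossing G (bag_union X C) \<subseteq> adhesion_set G T X f"
  proof
    fix e assume "e \<in> crossing G (bag_union X C)"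
    then have "e \<in> edges_between G (bag_union X C) (bag_union X (verts T - C))"
      using edges_between_compl[OF bag_subset[OF CT(1)]] bag_compl[OF CT(1)] by simp
    moreover have "C \<noteq> verts T - C" using t CT by auto
    ultimately show "e \<in> adhesion_set G T X f"
      unfolding adhesion_set_def using f(2) by blast
  qed
  moreover have "finite (adhesion_set G T X f)"
    using finite_edges by (auto simp: adhesion_set_def edges_between_def intro: finite_subset)
  ultimately have "cut_size G (bag_union X C) \<le> card (adhesion_set G T X f)"
    unfolding cut_size_def by (meson card_mono)
  also have "\<dots> \<le> adhesion G T X"
    unfolding adhesion_def using tree f by (intro Max_ge) (auto simp: is_tree_def multigraph_def)
  finally show ?thesis .
qed

lemma sum_branch_cut_size_le:
  assumes "t \<in> verts T"
  shows "(\<Sum>C\<in>branches t. cut_size G (bag_union X C)) \<le> card (branches t) * adhesion G T X"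
  using sum_bounded_above[of "branches t" "\<lambda>C. cut_size G (bag_union X C)" "adhesion G T X"]
    cut_size_branch_le_adhesion assms by auto

text \<open>If the bag at \<open>t\<close> is empty, an edge of the torso joins two branches and is counted in the
  cuts of both.\<close>

lemma torso_edges_empty_bag:
  assumes t: "t \<in> verts T" and empty: "X t = {}"
  shows "2 * card (edges (torso G T X t)) \<le> (\<Sum>C\<in>branches t. cut_size G (bag_union X C))"
proof -
  let ?E = "edges (torso G T X t)"
  let ?cross = "\<lambda>e C. e \<in> crossing G (bag_union X C)"
  have two: "2 \<le> card {C \<in> branches t. ?cross e C}" if e: "e \<in> ?E" for e
  proof -
    have eG: "e \<in> edges G" and notin: "\<And>C. C \<in> branches t \<Longrightarrow> \<not> ends G e \<subseteq> bag_union X C"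
      using e edges_torso[OF t] by auto
    have cover: "\<exists>C\<in>branches t. x \<in> bag_union X C" if "x \<in> ends G e" for x
      using Union_branch_bags[OF t] ends_in_verts[OF eG] empty that by auto
    obtain x where x: "x \<in> ends G e" using ends_nonempty[OF eG] by auto
    obtain C where C: "C \<in> branches t" "x \<in> bag_union X C" using cover[OF x] by auto
    obtain y where y: "y \<in> ends G e" "y \<notin> bag_union X C" using notin[OF C(1)] by auto
    obtain D where D: "D \<in> branches t" "y \<in> bag_union X D" using cover[OF y(1)] by auto
    have "C \<noteq> D" using D y by auto
    moreover have "{C, D} \<subseteq> {C \<in> branches t. ?cross e C}"
      using C D x y eG notin by (auto simp: crossing_def)
    ultimately show ?thesis
      using card_mono[of "{C \<in> branches t. ?cross e C}" "{C, D}"] finite_branches by simp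
  qed
  have "2 * card ?E = (\<Sum>e\<in>?E. 2)" by simp
  also have "\<dots> \<le> (\<Sum>e\<in>?E. card {C \<in> branches t. ?cross e C})"
    by (rule sum_mono) (rule two)
  also have "\<dots> = (\<Sum>C\<in>branches t. card {e \<in> ?E. ?cross e C})"
    using finite_branches finite_edges_torso by (intro sum_multicount_gen) auto
  also have "\<dots> \<le> (\<Sum>C\<in>branches t. cut_size G (bag_union X C))"
    unfolding cut_size_def by (intro sum_mono card_mono) auto
  finally show ?thesis .
qed

text \<open>Without loops, no edge has all its ends in a bag with one vertex, so every edge of the torso
  has an end in some branch and leaves that branch.\<close>

lemma torso_edges_singleton_bag:
  assumes t: "t \<in> verts T" and one: "card (X t) = 1" and "loopless G"
  shows "card (edges (torso G T X t)) \<le> (\<Sum>C\<in>branches t. cut_size G (bag_union X C))"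
proof -
  have "edges (torso G T X t) \<subseteq> (\<Union>C\<in>branches t. crossing G (bag_union X C))"
  proof
    fix e assume e: "e \<in> edges (torso G T X t)"
    then have eG: "e \<in> edges G" and notin: "\<And>C. C \<in> branches t \<Longrightarrow> \<not> ends G e \<subseteq> bag_union X C"
      using edges_torso[OF t] by auto
    have "\<not> ends G e \<subseteq> X t"
    proof
      assume "ends G e \<subseteq> X t"
      then have "card (ends G e) \<le> 1"
        using one by (metis card_mono card.infinite zero_neq_one)
      then show False
        using card_ends[OF eG] \<open>loopless G\<close> eG by (auto simp: loopless_def)
    qed
    then obtain x C where "x \<in> ends G e" "C \<in> branches t" "x \<in> bag_union X C"
      using Union_branch_bags[OF t] ends_in_verts[OF eG] by blast
    then show "e \<in> (\<Union>C\<in>branches t. crossing G (bag_union X C))"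
      using eG notin by (auto simp: crossing_def)
  qed
  then have "card (edges (torso G T X t)) \<le> card (\<Union>C\<in>branches t. crossing G (bag_union X C))"
    using finite_branches by (intro card_mono) auto
  also have "\<dots> \<le> (\<Sum>C\<in>branches t. cut_size G (bag_union X C))"
    unfolding cut_size_def by (rule card_UN_le[OF finite_branches])
  finally show ?thesis .
qed

lemma torso_edges_carving:
  assumes carving: "carving G T X" and "loopless G" and t: "t \<in> verts T"
  shows "2 * card (edges (torso G T X t)) \<le> 3 * adhesion G T X"
proof -
  have branches: "card (branches t) \<le> vertex_degree T t"
    using card_components_le_incident[OF tree t] by (simp add: vertex_degree_def)
  show ?thesis
  proof (cases "is_leaf T t")
    case True
    then have "card (X t) = 1" "card (branches t) \<le> 1"
      using carving t branches by (auto simp: carving_def weak_carving_def is_leaf_def)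
    have "card (edges (torso G T X t)) \<le> card (branches t) * adhesion G T X"
      using torso_edges_singleton_bag[OF t \<open>card (X t) = 1\<close> assms(2)] sum_branch_cut_size_le[OF t]
      by linarith
    also have "\<dots> \<le> 1 * adhesion G T X"
      using \<open>card (branches t) \<le> 1\<close> by (rule mult_le_mono1)
    finally show ?thesis by simp
  next
    case False
    then have "X t = {}" "card (branches t) \<le> 3"
      using carving t branches by (auto simp: carving_def weak_carving_def is_leaf_def)
    have "2 * card (edges (torso G T X t)) \<le> card (branches t) * adhesion G T X"
      using torso_edges_empty_bag[OF t \<open>X t = {}\<close>] sum_branch_cut_size_le[OF t]
      by linarith
    also have "\<dots> \<le> 3 * adhesion G T X"
      using \<open>card (branches t) \<le> 3\<close> by (rule mult_le_mono1)
    finally show ?thesis .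
  qed
qed

end

section \<open>Binary trees in heap order\<close>

text \<open>A binary tree is numbered like a heap: the children of \<open>n\<close> are \<open>2 * n\<close> and
  \<open>2 * n + 1\<close>. The whole tree hangs from the node 1, and the node 0 serves as an additional leaf
  above it, because \<open>1 div 2 = 0\<close>. So \<open>n div 2\<close> is the parent of every node except 0, and the
  edge to the parent of \<open>n\<close> can be called \<open>n\<close>.\<close>

text \<open>The node \<open>n\<close> lies in the subtree rooted at \<open>k\<close>.\<close>

definition below :: "nat \<Rightarrow> nat \<Rightarrow> bool" where
  "below k n \<longleftrightarrow> (\<exists>i. n div 2 ^ i = k)"

lemma below_refl [simp]: "below k k"
  unfolding below_def by (rule exI[of _ 0]) simp

lemma below_trans: "below k m \<Longrightarrow> below m n \<Longrightarrow> below k n"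
  unfolding below_def by (metis div_mult2_eq power_add)

lemma below_le: "below k n \<Longrightarrow> k \<le> n"
  unfolding below_def using div_le_dividend by blast

lemma below_parent: "below k (n div 2) \<Longrightarrow> below k n"
  unfolding below_def by (metis div_mult2_eq power_Suc)

lemma below_parent_iff:
  assumes "n \<noteq> k"
  shows "below k (n div 2) \<longleftrightarrow> below k n"
proof
  assume "below k n"
  then obtain i where i: "n div 2 ^ i = k" by (auto simp: below_def)
  with assms obtain j where "i = Suc j" by (cases i) auto
  with i have "n div 2 div 2 ^ j = k" by (simp add: div_mult2_eq)
  then show "below k (n div 2)" by (auto simp: below_def)
qed (rule below_parent)

lemma below_children: "below k (2 * k)" "below k (2 * k + 1)"
  by (rule below_parent, simp)+

lemma below_cases:
  assumes "below k n"
  shows "n = k \<or> below (2 * k) n \<or> below (2 * k + 1) n"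
proof -
  obtain i where i: "n div 2 ^ i = k" using assms by (auto simp: below_def)
  show ?thesis
  proof (cases i)
    case (Suc j)
    have "n div 2 ^ j div 2 = k"
      using i Suc by (simp add: div_mult2_eq[symmetric] mult.commute)
    then have "n div 2 ^ j = 2 * k \<or> n div 2 ^ j = 2 * k + 1"
      by linarith
    then show ?thesis by (auto simp: below_def)
  qed (use i in auto)
qed

lemma below_linear:
  assumes "below k n" "below l n"
  shows "below k l \<or> below l k"
proof -
  obtain i j where ij: "n div 2 ^ i = k" "n div 2 ^ j = l"
    using assms by (auto simp: below_def)
  have "n div 2 ^ (a + b) = n div 2 ^ a div 2 ^ b" for a b :: nat
    by (simp add: power_add div_mult2_eq)
  then have "below (n div 2 ^ (a + b)) (n div 2 ^ a)" for a b :: nat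
    by (auto simp: below_def)
  then show ?thesis
    using ij by (metis le_add_diff_inverse nat_le_linear)
qed

lemma below_siblings:
  assumes "k \<ge> 1"
  shows "\<not> (below (2 * k) n \<and> below (2 * k + 1) n)"
proof
  assume "below (2 * k) n \<and> below (2 * k + 1) n"
  then have "below (2 * k) (2 * k + 1) \<or> below (2 * k + 1) (2 * k)"
    using below_linear by blast
  then have "below (2 * k) k"
    using below_parent_iff[of "2 * k + 1" "2 * k"] below_le[of "2 * k + 1" "2 * k"] by auto
  then show False
    using below_le[of "2 * k" k] assms by simp
qed

lemma not_below_child:
  assumes "k \<ge> 1"
  shows "\<not> below (2 * k) k" "\<not> below (2 * k + 1) k"
  using below_le[of "2 * k" k] below_le[of "2 * k + 1" k] assms by auto

text \<open>An assembly arranged as a heap with top node \<open>k\<close>: the node \<open>n\<close> carries the set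
  \<open>Y n\<close>.\<close>

definition heap_layout ::
    "('a set \<Rightarrow> bool) \<Rightarrow> ('a set \<Rightarrow> bool) \<Rightarrow> nat \<Rightarrow> nat set \<Rightarrow> (nat \<Rightarrow> 'a set) \<Rightarrow> bool" where
  "heap_layout P L k N Y \<longleftrightarrow>
     finite N \<and> k \<in> N \<and> (\<forall>n\<in>N. below k n) \<and> (\<forall>n\<in>N. n \<noteq> k \<longrightarrow> n div 2 \<in> N) \<and>
     (\<forall>n\<in>N. P (Y n)) \<and>
     (\<forall>n\<in>N. 2 * n \<notin> N \<and> 2 * n + 1 \<notin> N \<and> L (Y n) \<or>
        2 * n \<in> N \<and> 2 * n + 1 \<in> N \<and> Y (2 * n) \<inter> Y (2 * n + 1) = {} \<and>
        Y n = Y (2 * n) \<union> Y (2 * n + 1))"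

text \<open>Since the two subtrees of \<open>k\<close> use disjoint sets of numbers, the layouts of two assemblies can
  be put together without renumbering.\<close>

lemma assembled_imp_heap_layout:
  assumes "assembled P L S" and "k \<ge> 1"
  shows "\<exists>N Y. heap_layout P L k N Y \<and> Y k = S"
  using assms
proof (induction arbitrary: k rule: assembled.induct)
  case (leaf S)
  then show ?case
    by (intro exI[of _ "{k}"] exI[of _ "\<lambda>_. S"]) (auto simp: heap_layout_def)
next
  case (join A B)
  obtain N1 Y1 where 1: "heap_layout P L (2 * k) N1 Y1" "Y1 (2 * k) = A"
    using join.IH(1)[of "2 * k"] join.prems by auto
  obtain N2 Y2 where 2: "heap_layout P L (2 * k + 1) N2 Y2" "Y2 (2 * k + 1) = B"
    using join.IH(2)[of "2 * k + 1"] join.prems by auto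
  define N where "N = insert k (N1 \<union> N2)"
  define Y where "Y n = (if n = k then A \<union> B else if n \<in> N1 then Y1 n else Y2 n)" for n
  have below1: "below (2 * k) n" if "n \<in> N1" for n
    using 1 that by (auto simp: heap_layout_def)
  have below2: "below (2 * k + 1) n" if "n \<in> N2" for n
    using 2 that by (auto simp: heap_layout_def)
  have disj: "n \<notin> N2" if "n \<in> N1" for n
    using below1[OF that] below2 below_siblings[OF join.prems] by blast
  have k: "k \<notin> N1" "k \<notin> N2"
    using below1 below2 not_below_child[OF join.prems] by blast+
  have Y_simps: "Y k = A \<union> B" "\<And>n. n \<in> N1 \<Longrightarrow> Y n = Y1 n" "\<And>n. n \<in> N2 \<Longrightarrow> Y n = Y2 n"
    using k disj by (auto simp: Y_def)
  have tops: "2 * k \<in> N1" "2 * k + 1 \<in> N2"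
    using 1 2 by (auto simp: heap_layout_def)
  have child1: "2 * n \<in> N \<longleftrightarrow> 2 * n \<in> N1" "2 * n + 1 \<in> N \<longleftrightarrow> 2 * n + 1 \<in> N1" if n: "n \<in> N1" for n
  proof -
    have *: "below (2 * k) (2 * n)" "below (2 * k) (2 * n + 1)"
      using below_children below1[OF n] below_trans by blast+
    then show "2 * n \<in> N \<longleftrightarrow> 2 * n \<in> N1" "2 * n + 1 \<in> N \<longleftrightarrow> 2 * n + 1 \<in> N1"
      using below2 below_siblings[OF join.prems] not_below_child[OF join.prems]
      unfolding N_def by (metis UnE insertE insertI2 UnI1)+
  qed
  have child2: "2 * n \<in> N \<longleftrightarrow> 2 * n \<in> N2" "2 * n + 1 \<in> N \<longleftrightarrow> 2 * n + 1 \<in> N2" if n: "n \<in> N2" for n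
  proof -
    have *: "below (2 * k + 1) (2 * n)" "below (2 * k + 1) (2 * n + 1)"
      using below_children below2[OF n] below_trans by blast+
    then show "2 * n \<in> N \<longleftrightarrow> 2 * n \<in> N2" "2 * n + 1 \<in> N \<longleftrightarrow> 2 * n + 1 \<in> N2"
      using below1 below_siblings[OF join.prems] not_below_child[OF join.prems]
      unfolding N_def by (metis UnE insertE insertI2 UnI2)+
  qed
  have "heap_layout P L k N Y"
    unfolding heap_layout_def
  proof (intro conjI ballI impI)
    show "finite N" "k \<in> N"
      using 1 2 by (auto simp: heap_layout_def N_def)
    fix n assume "n \<in> N"
    then consider "n = k" | "n \<in> N1" | "n \<in> N2" by (auto simp: N_def)
    note cases = this
    show "below k n"
      using cases below1 below2 below_children below_trans by (metis below_refl)
    show "n div 2 \<in> N" if "n \<noteq> k"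
    proof -
      have "n div 2 \<in> N1" if "n \<in> N1" "n \<noteq> 2 * k"
        using 1 that by (auto simp: heap_layout_def)
      moreover have "n div 2 \<in> N2" if "n \<in> N2" "n \<noteq> 2 * k + 1"
        using 2 that by (auto simp: heap_layout_def)
      moreover have "n div 2 = k" if "n = 2 * k \<or> n = 2 * k + 1"
        using that by linarith
      ultimately have "n div 2 \<in> N1 \<or> n div 2 \<in> N2 \<or> n div 2 = k"
        using cases \<open>n \<noteq> k\<close> by blast
      then show ?thesis by (auto simp: N_def)
    qed
    show "P (Y n)"
    proof -
      have "P (Y1 n)" if "n \<in> N1"
        using 1(1) that unfolding heap_layout_def by blast
      moreover have "P (Y2 n)" if "n \<in> N2"
        using 2(1) that unfolding heap_layout_def by blast
      ultimately show ?thesis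
        using cases join.hyps Y_simps by metis
    qed
    show "2 * n \<notin> N \<and> 2 * n + 1 \<notin> N \<and> L (Y n) \<or>
        2 * n \<in> N \<and> 2 * n + 1 \<in> N \<and> Y (2 * n) \<inter> Y (2 * n + 1) = {} \<and>
        Y n = Y (2 * n) \<union> Y (2 * n + 1)"
      using cases
    proof cases
      case a: 1
      then show ?thesis
        using tops 1(2) 2(2) Y_simps(1) Y_simps(2)[OF tops(1)] Y_simps(3)[OF tops(2)] join.hyps
        by (simp add: N_def)
    next
      case a: 2
      then have "2 * n \<notin> N1 \<and> 2 * n + 1 \<notin> N1 \<and> L (Y1 n) \<or>
        2 * n \<in> N1 \<and> 2 * n + 1 \<in> N1 \<and> Y1 (2 * n) \<inter> Y1 (2 * n + 1) = {} \<and>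
        Y1 n = Y1 (2 * n) \<union> Y1 (2 * n + 1)"
        using 1(1) unfolding heap_layout_def by blast
      then show ?thesis
        using child1[OF a] Y_simps(2) a by metis
    next
      case a: 3
      then have "2 * n \<notin> N2 \<and> 2 * n + 1 \<notin> N2 \<and> L (Y2 n) \<or>
        2 * n \<in> N2 \<and> 2 * n + 1 \<in> N2 \<and> Y2 (2 * n) \<inter> Y2 (2 * n + 1) = {} \<and>
        Y2 n = Y2 (2 * n) \<union> Y2 (2 * n + 1)"
        using 2(1) unfolding heap_layout_def by blast
      then show ?thesis
        using child2[OF a] Y_simps(3) a by metis
    qed
  qed
  then show ?case using Y_simps(1) by blast
qed

definition heap_tree :: "nat set \<Rightarrow> (nat, nat) mgraph" where
  "heap_tree N = \<lparr>verts = insert 0 N, edges = N, ends = (\<lambda>n. {n, n div 2})\<rparr>"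

lemma heap_tree_simps [simp]:
  "verts (heap_tree N) = insert 0 N" "edges (heap_tree N) = N" "ends (heap_tree N) n = {n, n div 2}"
  by (simp_all add: heap_tree_def)

text \<open>The largest node of a cycle would be the lower end of both of its edges on the cycle,
  but only one edge has a given lower end.\<close>

lemma heap_tree_acyclic:
  assumes "0 \<notin> N"
  shows "\<not> is_cycle (heap_tree N) vs es"
proof
  assume cyc: "is_cycle (heap_tree N) vs es"
  then have vs: "vs \<noteq> []" "length es = length vs" "distinct es" "set es \<subseteq> N"
    and ends: "\<And>i. i < length vs \<Longrightarrow> {es ! i, es ! i div 2} = {vs ! i, vs ! (Suc i mod length vs)}"
    by (auto simp: is_cycle_def)
  have pos: "es ! i div 2 < es ! i" if "i < length vs" for i
  proof -
    have "es ! i \<in> N" using vs that by auto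
    then have "es ! i \<noteq> 0" using assms by metis
    then show ?thesis by simp
  qed
  define m where "m = Max (set vs)"
  have "m \<in> set vs" using vs by (simp add: m_def)
  then obtain j where j: "j < length vs" "vs ! j = m" by (auto simp: in_set_conv_nth)
  have top: "es ! i = m" if i: "i < length vs" "m \<in> {es ! i, es ! i div 2}" for i
  proof -
    have "es ! i \<in> {vs ! i, vs ! (Suc i mod length vs)}"
      using ends[OF i(1)] by blast
    moreover have "Suc i mod length vs < length vs"
      using vs by simp
    ultimately have "es ! i \<in> set vs"
      using i(1) by auto
    then have "es ! i \<le> m" by (simp add: m_def)
    then show ?thesis using i pos[OF i(1)] by auto
  qed
  define i where "i = (if j = 0 then length vs - 1 else j - 1)"
  have i: "i < length vs" "Suc i mod length vs = j"
    using vs j by (auto simp: i_def)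
  have same: "es ! i = m" "es ! j = m"
    using top i j ends[OF i(1)] ends[OF j(1)] by auto
  then have "i = j"
    using nth_eq_iff_index_eq[of es i j] vs(2,3) i(1) j(1) by simp
  have "es ! i div 2 \<in> {vs ! i, vs ! j}"
    using ends[OF i(1)] unfolding i(2) by blast
  then have "es ! j div 2 = m"
    using \<open>i = j\<close> j(2) by simp
  then show False
    using pos[OF j(1)] same(2) by simp
qed

locale heap = multigraph G for G :: "('v, 'e) mgraph" +
  fixes L :: "'v set \<Rightarrow> bool" and k :: nat and N :: "nat set" and Y :: "nat \<Rightarrow> 'v set"
  assumes layout: "heap_layout (low k) L 1 N Y"
begin

lemma finite_heap: "finite N" and top_in_heap: "1 \<in> N"
  and below_top: "n \<in> N \<Longrightarrow> below 1 n"
  and parent_in_heap: "n \<in> N \<Longrightarrow> n \<noteq> 1 \<Longrightarrow> n div 2 \<in> N"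
  and low_Y: "n \<in> N \<Longrightarrow> low k (Y n)"
  using layout by (auto simp: heap_layout_def)

lemma heap_cases:
  assumes "n \<in> N"
  obtains (leaf) "2 * n \<notin> N" "2 * n + 1 \<notin> N" "L (Y n)"
    | (inner) "2 * n \<in> N" "2 * n + 1 \<in> N" "Y (2 * n) \<inter> Y (2 * n + 1) = {}"
        "Y n = Y (2 * n) \<union> Y (2 * n + 1)"
  using layout assms unfolding heap_layout_def by blast

lemma zero_notin_heap: "0 \<notin> N"
  using below_top[of 0] below_le[of 1 0] by auto

lemma heap_pos: "n \<in> N \<Longrightarrow> 1 \<le> n"
  using below_top below_le by blast

abbreviation T where "T \<equiv> heap_tree N"

definition subheap :: "nat \<Rightarrow> nat set" where
  "subheap n = {m \<in> N. below n m}"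

lemma subheap_top: "subheap 1 = N"
  using below_top by (auto simp: subheap_def)

lemma mem_subheap: "n \<in> N \<Longrightarrow> n \<in> subheap n"
  by (simp add: subheap_def)

lemma subheap_parent:
  assumes "m \<in> subheap n" "m \<noteq> n" "n \<in> N"
  shows "m div 2 \<in> subheap n"
proof -
  have m: "m \<in> N" "below n m" using assms by (auto simp: subheap_def)
  have "m \<noteq> 1"
    using m below_le[of n 1] heap_pos[OF assms(3)] assms(2) by auto
  then show ?thesis
    using parent_in_heap[OF m(1)] below_parent_iff[OF assms(2)] m(2) by (simp add: subheap_def)
qed

text \<open>Walking up from a node below \<open>n\<close> reaches \<open>n\<close>, and walking up from any other node reaches 0.
  The first walk stays below \<open>n\<close> and the second never gets there, so these sets of nodes remain
  connected when a node or an edge elsewhere is deleted.\<close>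

lemma linked_subheap:
  assumes H: "\<And>m. m \<in> N \<Longrightarrow> {m, m div 2} \<subseteq> subheap n \<Longrightarrow> m \<in> edges H"
    and ends: "ends H = ends T" and n: "n \<in> N" and u: "u \<in> subheap n"
  shows "linked H u n"
  using u
proof (induction u rule: less_induct)
  case (less u)
  show ?case
  proof (cases "u = n")
    case False
    have up: "u div 2 \<in> subheap n" and uN: "u \<in> N"
      using subheap_parent[OF less.prems False n] less.prems by (auto simp: subheap_def)
    have "u \<in> edges H"
      using H[OF uN] up less.prems by simp
    then have "linked H u (u div 2)"
      by (rule linked_edge) (simp add: ends)
    moreover have "linked H (u div 2) n"
      using less.IH[OF _ up] heap_pos[OF uN] by simp
    ultimately show ?thesis by (rule rtrancl_trans)
  qed simp
qed

lemma linked_outside_subheap: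
  assumes H: "\<And>m. m \<in> N \<Longrightarrow> {m, m div 2} \<inter> subheap n = {} \<Longrightarrow> m \<in> edges H"
    and ends: "ends H = ends T" and n: "n \<in> N" and u: "u \<in> verts T - subheap n"
  shows "linked H u 0"
  using u
proof (induction u rule: less_induct)
  case (less u)
  show ?case
  proof (cases "u = 0")
    case False
    then have uN: "u \<in> N" using less.prems by simp
    have up: "u div 2 \<notin> subheap n"
      using less.prems below_parent[of n u] uN by (auto simp: subheap_def)
    have "u \<in> edges H"
      using H[OF uN] up less.prems by simp
    then have "linked H u (u div 2)"
      by (rule linked_edge) (simp add: ends)
    moreover have "u div 2 \<in> verts T"
      using parent_in_heap[OF uN] by (cases "u = 1") auto
    then have "linked H (u div 2) 0"
      using less.IH[of "u div 2"] up heap_pos[OF uN] by simp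
    ultimately show ?thesis by (rule rtrancl_trans)
  qed simp
qed

lemma is_tree_heap: "is_tree T"
  unfolding is_tree_def
proof (intro conjI)
  show "multigraph T"
  proof
    show "finite (verts T)" "finite (edges T)" using finite_heap by auto
    fix n assume n: "n \<in> edges T"
    then show "ends T n \<subseteq> verts T"
      using parent_in_heap[of n] by (cases "n = 1") auto
    have "n \<noteq> n div 2" using heap_pos[of n] n by simp
    then show "card (ends T n) = 1 \<or> card (ends T n) = 2" by simp
  qed
  show "graph_connected T"
  proof -
    have "linked T u 1" if "u \<in> N" for u
      using linked_subheap[of 1 T u] top_in_heap that unfolding subheap_top by simp
    moreover have "linked T 1 0"
      by (rule linked_edge[of 1]) (use top_in_heap in auto)
    ultimately have "linked T u 0" if "u \<in> verts T" for u
      using that by (auto intro: rtrancl_trans)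
    then have "linked T u v" if "u \<in> verts T" "v \<in> verts T" for u v
      using rtrancl_trans[OF _ linked_sym[of v 0 T], of u] that by simp
    then show ?thesis by (auto simp: graph_connected_def)
  qed
  show "\<nexists>vs es. is_cycle T vs es"
    using heap_tree_acyclic[OF zero_notin_heap] by blast
qed

text \<open>The pieces of the assembly are the bags of the leaves; the additional leaf 0 takes the vertices
  outside the assembled set.\<close>

definition bag :: "nat \<Rightarrow> 'v set" where
  "bag n = (if n = 0 then verts G - Y 1 else if 2 * n \<in> N then {} else Y n)"

lemma subheap_leaf:
  assumes "n \<in> N" "2 * n \<notin> N" "2 * n + 1 \<notin> N"
  shows "subheap n = {n}"
proof -
  have "m = n" if m: "m \<in> subheap n" for m
    using m
  proof (induction m rule: less_induct)
    case (less m)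
    show ?case
    proof (rule ccontr)
      assume "m \<noteq> n"
      from subheap_parent[OF less.prems this assms(1)] have up: "m div 2 \<in> subheap n" .
      have mN: "m \<in> N" using less.prems by (simp add: subheap_def)
      have "m div 2 < m" using heap_pos[OF mN] by simp
      then have "m div 2 = n" using less.IH up by blast
      then have "m = 2 * n \<or> m = 2 * n + 1" by linarith
      with mN assms show False by auto
    qed
  qed
  then show ?thesis using mem_subheap[OF assms(1)] by blast
qed

lemma subheap_inner:
  assumes "n \<in> N"
  shows "subheap n = insert n (subheap (2 * n) \<union> subheap (2 * n + 1))"
proof (intro equalityI subsetI)
  fix m assume "m \<in> insert n (subheap (2 * n) \<union> subheap (2 * n + 1))"
  then show "m \<in> subheap n"
    using below_children[of n] below_trans assms by (auto simp: subheap_def)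
qed (use below_cases in \<open>auto simp: subheap_def\<close>)

lemma bags_subheap:
  assumes "n \<in> N"
  shows "bag_union bag (subheap n) = Y n \<and> disjoint_family_on bag (subheap n)"
  using assms
proof (induction "Max N - n" arbitrary: n rule: less_induct)
  case less
  note pos = heap_pos[OF less.prems]
  from less.prems show ?case
  proof (cases rule: heap_cases)
    case leaf
    then show ?thesis
      using subheap_leaf[OF less.prems] pos
      by (simp add: bag_union_def bag_def disjoint_family_on_def)
  next
    case inner
    have max: "2 * n \<le> Max N" "2 * n + 1 \<le> Max N"
      using inner finite_heap by auto
    have IH: "bag_union bag (subheap (2 * n)) = Y (2 * n)"
        "disjoint_family_on bag (subheap (2 * n))"
        "bag_union bag (subheap (2 * n + 1)) = Y (2 * n + 1)"
        "disjoint_family_on bag (subheap (2 * n + 1))"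
      using less.hyps[of "2 * n"] less.hyps[of "2 * n + 1"] inner max pos by auto
    have "bag n = {}" using inner pos by (simp add: bag_def)
    have siblings: "bag l \<inter> bag m = {}"
      if "l \<in> subheap (2 * n)" "m \<in> subheap (2 * n + 1)" for l m
      using that IH(1,3) inner(3) by (auto simp: bag_union_def)
    have "disjoint_family_on bag (subheap n)"
      unfolding disjoint_family_on_def
    proof (intro ballI impI)
      fix l m assume "l \<in> subheap n" "m \<in> subheap n" "l \<noteq> m"
      then consider "l = n \<or> m = n"
        | "l \<in> subheap (2 * n)" "m \<in> subheap (2 * n)"
        | "l \<in> subheap (2 * n + 1)" "m \<in> subheap (2 * n + 1)"
        | "l \<in> subheap (2 * n)" "m \<in> subheap (2 * n + 1)"
        | "m \<in> subheap (2 * n)" "l \<in> subheap (2 * n + 1)"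
        unfolding subheap_inner[OF less.prems] by auto
      then show "bag l \<inter> bag m = {}"
      proof cases
        case 1
        then show ?thesis using \<open>bag n = {}\<close> by auto
      next
        case 2
        then show ?thesis using IH(2) \<open>l \<noteq> m\<close> by (simp add: disjoint_family_on_def)
      next
        case 3
        then show ?thesis using IH(4) \<open>l \<noteq> m\<close> by (simp add: disjoint_family_on_def)
      next
        case 4
        then show ?thesis by (rule siblings)
      next
        case 5
        then show ?thesis using siblings[of m l] by blast
      qed
    qed
    moreover have "bag_union bag (subheap n) = Y n"
      using IH(1,3) \<open>bag n = {}\<close> inner(4)
      unfolding subheap_inner[OF less.prems] by (simp add: bag_union_def)
    ultimately show ?thesis by simp
  qed
qed

lemma Y_subset: "n \<in> N \<Longrightarrow> Y n \<subseteq> verts G"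
  using low_Y by (simp add: low_def)

end

sublocale heap \<subseteq> tree_cut G "heap_tree N" bag
proof
  have top: "(\<Union>n\<in>N. bag n) = Y 1" "disjoint_family_on bag N"
    using bags_subheap[OF top_in_heap] subheap_top by (auto simp: bag_union_def)
  have root: "bag 0 = verts G - Y 1" by (simp add: bag_def)
  have "disjoint_family_on bag (insert 0 N)"
    using top root by (auto simp: disjoint_family_on_def)
  moreover have "(\<Union>n\<in>insert 0 N. bag n) = verts G"
    using top root Y_subset[OF top_in_heap] by auto
  ultimately show "tree_cut_decomposition G T bag"
    using is_tree_heap by (simp add: tree_cut_decomposition_def)
qed

context heap
begin

lemma subheap_subset: "subheap n \<subseteq> verts T"
  by (auto simp: subheap_def)

lemma bag_outside_subheap:
  "n \<in> N \<Longrightarrow> bag_union bag (verts T - subheap n) = verts G - Y n"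
  using bag_compl[OF subheap_subset] bags_subheap by metis

text \<open>The nodes below \<open>n\<close>, or the other nodes, whichever do not include \<open>t\<close>, lie in a single branch
  at \<open>t\<close>.\<close>

lemma torso_edge_not_inside:
  assumes t: "t \<in> verts T" and e: "e \<in> edges (torso G T bag t)" and n: "n \<in> N"
  shows "t \<notin> subheap n \<Longrightarrow> \<not> ends G e \<subseteq> Y n"
    and "t \<in> subheap n \<Longrightarrow> \<not> ends G e \<subseteq> verts G - Y n"
proof -
  have not_inside: "\<not> ends G e \<subseteq> bag_union bag S"
    if S: "S \<subseteq> verts T - {t}" "c \<in> S" "\<And>u. u \<in> S \<Longrightarrow> linked (delete_vertex T t) u c" for S c
  proof -
    have "linked (delete_vertex T t) u v" if "u \<in> S" "v \<in> S" for u v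
      using S(3) that by (meson linked_sym rtrancl_trans)
    then obtain C where "C \<in> branches t" "S \<subseteq> C"
      using linked_subset_component[of S "delete_vertex T t"] S(1,2)
      by (metis emptyE verts_delete(1))
    moreover from this have "bag_union bag S \<subseteq> bag_union bag C"
      by (auto simp: bag_union_def)
    ultimately show ?thesis
      using e edges_torso[OF t] by blast
  qed
  show "\<not> ends G e \<subseteq> Y n" if "t \<notin> subheap n"
  proof -
    have "linked (delete_vertex T t) u n" if "u \<in> subheap n" for u
      by (rule linked_subheap[OF _ _ n that]) (use \<open>t \<notin> subheap n\<close> in auto)
    then show ?thesis
      using not_inside[of "subheap n" n] that mem_subheap[OF n] subheap_subset bags_subheap[OF n]
      by auto
  qed
  show "\<not> ends G e \<subseteq> verts G - Y n" if "t \<in> subheap n"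
  proof -
    have "linked (delete_vertex T t) u 0" if "u \<in> verts T - subheap n" for u
      by (rule linked_outside_subheap[OF _ _ n that]) (use \<open>t \<in> subheap n\<close> in auto)
    moreover have "0 \<notin> subheap n"
      using zero_notin_heap by (simp add: subheap_def)
    ultimately show ?thesis
      using not_inside[of "verts T - subheap n" 0] that bag_outside_subheap[OF n]
      by auto
  qed
qed

text \<open>Deleting the edge to the parent of \<open>n\<close> leaves the part of the heap below \<open>n\<close> and the
  rest.\<close>

lemma adhesion_set_heap:
  assumes n: "n \<in> N"
  shows "adhesion_set G T bag n \<subseteq> crossing G (Y n)"
proof
  fix e assume "e \<in> adhesion_set G T bag n"
  then obtain A B where comps: "graph_components (delete_edge T n) = {A, B}" "A \<noteq> B"
    and e: "e \<in> edges_between G (bag_union bag A) (bag_union bag B)"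
    by (auto simp: adhesion_set_def)
  let ?H = "delete_edge T n"
  have up: "n div 2 \<notin> subheap n"
    using below_le[of n "n div 2"] heap_pos[OF n] by (auto simp: subheap_def)
  have "linked ?H u n" if "u \<in> subheap n" for u
    by (rule linked_subheap[OF _ _ n that]) (use up in auto)
  then have "linked ?H u v" if "u \<in> subheap n" "v \<in> subheap n" for u v
    using that by (meson linked_sym rtrancl_trans)
  then obtain C where C: "C \<in> {A, B}" "subheap n \<subseteq> C"
    using linked_subset_component[of "subheap n" ?H] mem_subheap[OF n] subheap_subset
    by (metis comps(1) emptyE verts_delete(2))
  have "linked ?H u 0" if "u \<in> verts T - subheap n" for u
    by (rule linked_outside_subheap[OF _ _ n that]) (use mem_subheap[OF n] in auto)
  then have "linked ?H u v" if "u \<in> verts T - subheap n" "v \<in> verts T - subheap n" for u v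
    using that by (meson linked_sym rtrancl_trans)
  moreover have "0 \<in> verts T - subheap n"
    using zero_notin_heap by (simp add: subheap_def)
  ultimately obtain D where D: "D \<in> {A, B}" "verts T - subheap n \<subseteq> D"
    using linked_subset_component[of "verts T - subheap n" ?H]
    by (metis comps(1) emptyE verts_delete(2) Diff_subset)
  have "A \<inter> B = {}" "A \<noteq> {}" "B \<noteq> {}" "A \<union> B = verts T"
    using components_disjoint[of A ?H B] component_nonempty[of _ ?H] Union_components[of ?H] comps
    by auto
  then have "{A, B} = {subheap n, verts T - subheap n}"
    using C D subheap_subset[of n] by blast
  then consider "A = subheap n" "B = verts T - subheap n" | "B = subheap n" "A = verts T - subheap n"
    by (auto simp: doubleton_eq_iff)
  then show "e \<in> crossing G (Y n)"
    using e bags_subheap[OF n] bag_outside_subheap[OF n] edges_between_compl[OF Y_subset[OF n]]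
      edges_between_compl'[OF Y_subset[OF n]]
    by cases auto
qed

lemma adhesion_heap: "adhesion G T bag \<le> k - 1"
proof -
  have "card (adhesion_set G T bag n) \<le> k - 1" if n: "n \<in> N" for n
  proof -
    have "card (adhesion_set G T bag n) \<le> cut_size G (Y n)"
      unfolding cut_size_def by (rule card_mono[OF finite_crossing adhesion_set_heap[OF n]])
    then show ?thesis using low_Y[OF n] by (auto simp: low_def)
  qed
  then show ?thesis
    using finite_heap by (auto simp: adhesion_def)
qed

lemma vertex_degree_heap:
  assumes "n \<in> verts T"
  shows "vertex_degree T n = (if 2 * n \<in> N then 3 else 1)"
proof -
  have "m \<noteq> m div 2" if "m \<in> N" for m
    using heap_pos[OF that] by simp
  then have "{m \<in> N. {m, m div 2} = {n}} = {}"
    by (metis (mono_tags, lifting) Collect_empty_eq insertI1 insertI2 singletonD)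
  moreover have "card {m \<in> N. n \<in> {m, m div 2}} = (if 2 * n \<in> N then 3 else 1)"
  proof (cases "n = 0")
    case True
    \<comment> \<open>Only the edge 1 is incident with the node 0.\<close>
    have "m \<in> N \<and> (m = 0 \<or> m div 2 = 0) \<longleftrightarrow> m = 1" for m
    proof
      assume m: "m \<in> N \<and> (m = 0 \<or> m div 2 = 0)"
      then have "m \<noteq> 0" using zero_notin_heap by metis
      with m show "m = 1" by linarith
    qed (use top_in_heap in auto)
    then have "{m \<in> N. n \<in> {m, m div 2}} = {1}"
      using True by auto
    then show ?thesis using True zero_notin_heap by simp
  next
    case False
    then have nN: "n \<in> N" using assms by simp
    have "m div 2 = n \<longleftrightarrow> m = 2 * n \<or> m = 2 * n + 1" for m by linarith
    then have eq: "{m \<in> N. n \<in> {m, m div 2}} = {n} \<union> (N \<inter> {2 * n, 2 * n + 1})"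
      using nN by auto
    from nN show ?thesis
    proof (cases rule: heap_cases)
      case leaf
      then show ?thesis unfolding eq by simp
    next
      case inner
      then have "{n} \<union> (N \<inter> {2 * n, 2 * n + 1}) = {n, 2 * n, 2 * n + 1}" by auto
      then show ?thesis unfolding eq using inner False by simp
    qed
  qed
  ultimately show ?thesis
    by (simp add: vertex_degree_def)
qed

lemma carving_heap:
  assumes "\<And>S. L S \<Longrightarrow> is_singleton_set S" and "is_singleton_set (verts G - Y 1)"
  shows "carving G T bag"
proof -
  have "card (bag n) = 1" if "n \<in> verts T" "2 * n \<notin> N" for n
  proof (cases "n = 0")
    case True
    then show ?thesis using assms(2) by (auto simp: bag_def)
  next
    case False
    then have "n \<in> N" using that by simp
    then have "is_singleton_set (Y n)"
      using assms(1) that by (cases rule: heap_cases) auto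
    then show ?thesis using False that by (auto simp: bag_def)
  qed
  moreover have "bag n = {}" if "2 * n \<in> N" for n
    using that zero_notin_heap by (cases "n = 0") (auto simp: bag_def)
  ultimately show ?thesis
    using decomposition vertex_degree_heap
    by (auto simp: carving_def weak_carving_def is_leaf_def)
qed

text \<open>An edge of the torso at an inner node crosses the set at one of its children, or else it
  would avoid the set at the node itself.\<close>

lemma torso_edges_heap:
  assumes all: "Y 1 = verts G"
    and few: "\<And>S. L S \<Longrightarrow> card (incident_edges G S) < k"
    and t: "t \<in> verts T"
  shows "card (edges (torso G T bag t)) \<le> 2 * (k - 1)"
proof -
  consider "t = 0" | "t \<in> N" using t by auto
  then show ?thesis
  proof cases
    case 1
    have "edges (torso G T bag t) = {}"
    proof -
      have "False" if "e \<in> edges (torso G T bag t)" for e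
        using torso_edge_not_inside(1)[OF t that top_in_heap] 1 zero_notin_heap all
          ends_in_verts[of e] that by (auto simp: subheap_def torso_def)
      then show ?thesis by auto
    qed
    then show ?thesis by simp
  next
    case tN: 2
    have meets: "ends G e \<inter> Y t \<noteq> {}" if e: "e \<in> edges (torso G T bag t)" for e
      using torso_edge_not_inside(2)[OF t e tN mem_subheap[OF tN]] ends_in_verts[of e] e
      by (auto simp: torso_def)
    from tN show ?thesis
    proof (cases rule: heap_cases)
      case leaf
      have "edges (torso G T bag t) \<subseteq> incident_edges G (Y t)"
        using meets by (auto simp: incident_edges_def torso_def)
      moreover have "finite (incident_edges G (Y t))"
        using finite_edges by (simp add: incident_edges_def)
      ultimately have "card (edges (torso G T bag t)) \<le> card (incident_edges G (Y t))"
        by (rule card_mono[rotated])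
      then show ?thesis using few[OF leaf(3)] by linarith
    next
      case inner
      have notin: "t \<notin> subheap (2 * t)" "t \<notin> subheap (2 * t + 1)"
        using not_below_child[OF heap_pos[OF tN]] by (auto simp: subheap_def)
      have "edges (torso G T bag t) \<subseteq> crossing G (Y (2 * t)) \<union> crossing G (Y (2 * t + 1))"
      proof
        fix e assume e: "e \<in> edges (torso G T bag t)"
        show "e \<in> crossing G (Y (2 * t)) \<union> crossing G (Y (2 * t + 1))"
          using meets[OF e] inner(4) torso_edge_not_inside(1)[OF t e inner(1) notin(1)]
            torso_edge_not_inside(1)[OF t e inner(2) notin(2)] e
          by (auto simp: crossing_def torso_def)
      qed
      then have "card (edges (torso G T bag t))
          \<le> card (crossing G (Y (2 * t)) \<union> crossing G (Y (2 * t + 1)))"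
        by (intro card_mono) auto
      also have "\<dots> \<le> cut_size G (Y (2 * t)) + cut_size G (Y (2 * t + 1))"
        unfolding cut_size_def by (rule card_Un_le)
      finally show ?thesis
        using low_Y[OF inner(1)] low_Y[OF inner(2)] by (auto simp: low_def)
    qed
  qed
qed

end

section \<open>Torso-width, carving-width and edge-tangles\<close>

context multigraph
begin

text \<open>The tree with a single node. It makes the minimum in \<open>tree_cut_torso_width\<close> a minimum over a
  nonempty set.\<close>

lemma exists_decomposition: "\<exists>(T :: (nat, nat) mgraph) X. tree_cut_decomposition G T X"
proof -
  define T :: "(nat, nat) mgraph" where "T = heap_tree {}"
  have "multigraph T" "graph_connected T"
    by (auto simp: T_def multigraph_def graph_connected_def)
  then have "is_tree T"
    using heap_tree_acyclic[of "{}"] by (auto simp: is_tree_def T_def)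
  then have "tree_cut_decomposition G T (\<lambda>_. verts G)"
    by (auto simp: tree_cut_decomposition_def T_def disjoint_family_on_def)
  then show ?thesis by blast
qed

lemma tree_cut_torso_width_le_iff:
  "tree_cut_torso_width G \<le> w \<longleftrightarrow> (\<exists>(T :: (nat, nat) mgraph) X. tree_cut_decomposition G T X \<and>
     (\<forall>t\<in>verts T. card (edges (torso G T X t)) \<le> w))"
proof -
  let ?width = "\<lambda>w. \<exists>(T :: (nat, nat) mgraph) X. tree_cut_decomposition G T X \<and> torso_width G T X = w"
  have iff: "torso_width G T X \<le> w \<longleftrightarrow> (\<forall>t\<in>verts T. card (edges (torso G T X t)) \<le> w)"
    if "tree_cut_decomposition G T X" for T :: "(nat, nat) mgraph" and X w
  proof -
    interpret tree_cut G T X by unfold_locales (fact that)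
    show ?thesis by (rule torso_width_le_iff)
  qed
  have least: "tree_cut_torso_width G \<le> torso_width G T X" if "tree_cut_decomposition G T X"
    for T :: "(nat, nat) mgraph" and X
    unfolding tree_cut_torso_width_def using that by (intro Least_le) blast
  have "\<exists>w. ?width w"
    using exists_decomposition by blast
  from LeastI_ex[OF this] obtain T :: "(nat, nat) mgraph" and X where
    TX: "tree_cut_decomposition G T X" "torso_width G T X = tree_cut_torso_width G"
    by (auto simp: tree_cut_torso_width_def)
  show ?thesis
  proof
    assume "tree_cut_torso_width G \<le> w"
    then show "\<exists>(T :: (nat, nat) mgraph) X. tree_cut_decomposition G T X \<and>
        (\<forall>t\<in>verts T. card (edges (torso G T X t)) \<le> w)"
      using TX iff[OF TX(1), of w] by auto
  next
    assume "\<exists>(T :: (nat, nat) mgraph) X. tree_cut_decomposition G T X \<and>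
        (\<forall>t\<in>verts T. card (edges (torso G T X t)) \<le> w)"
    then show "tree_cut_torso_width G \<le> w"
      using least iff by (blast intro: order_trans)
  qed
qed

text \<open>As some decomposition always exists, this also shows that graphs with at least two vertices
  have carvings.\<close>

lemma carving_if_torso_width_le:
  assumes two: "2 \<le> card (verts G)" and width: "tree_cut_torso_width G \<le> w"
  shows "\<exists>(T :: (nat, nat) mgraph) X. carving G T X \<and> adhesion G T X \<le> w"
proof -
  obtain T :: "(nat, nat) mgraph" and X where TX: "tree_cut_decomposition G T X"
    "\<And>t. t \<in> verts T \<Longrightarrow> card (edges (torso G T X t)) \<le> w"
    using width tree_cut_torso_width_le_iff by auto
  interpret tree_cut G T X by unfold_locales (fact TX)
  obtain v where v: "v \<in> verts G"
    using two by (metis all_not_in_conv card.empty not_numeral_le_zero)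
  have "assembled (low (Suc w)) is_singleton_set (verts G - {v})"
    using assembled_delete_vertex[OF _ v two] TX(2) by (simp add: less_Suc_eq_le)
  from assembled_imp_heap_layout[OF this, of 1] obtain N Y where
    NY: "heap_layout (low (Suc w)) is_singleton_set 1 N Y" "Y 1 = verts G - {v}" by auto
  interpret heap: heap G is_singleton_set "Suc w" N Y by unfold_locales (fact NY)
  have "is_singleton_set (verts G - Y 1)"
    using v NY(2) by (intro exI[of _ v]) auto
  then have "carving G heap.T heap.bag"
    by (intro heap.carving_heap)
  then show ?thesis
    using heap.adhesion_heap by auto
qed

lemma carving_width_le_torso_width: "carving_width G \<le> tree_cut_torso_width G"
proof (cases "card (verts G) \<le> 1")
  case False
  then have "\<exists>(T :: (nat, nat) mgraph) X. carving G T X \<and> adhesion G T X \<le> tree_cut_torso_width G"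
    using carving_if_torso_width_le by simp
  then show ?thesis
    using False unfolding carving_width_def by (simp add: Least_le)
qed (simp add: carving_width_def)

lemma no_edge_tangle_if_torso_width_le:
  assumes "tree_cut_torso_width G \<le> w"
  shows "\<not> edge_tangle G (w + 1) \<E>"
proof -
  obtain T :: "(nat, nat) mgraph" and X where TX: "tree_cut_decomposition G T X"
    "\<And>t. t \<in> verts T \<Longrightarrow> card (edges (torso G T X t)) \<le> w"
    using assms tree_cut_torso_width_le_iff by auto
  interpret tree_cut G T X by unfold_locales (fact TX)
  show ?thesis
    by (rule no_edge_tangle) (use TX(2) in \<open>simp add: less_Suc_eq_le\<close>)
qed

lemma torso_width_le_carving_width:
  assumes "loopless G"
  shows "2 * tree_cut_torso_width G \<le> 3 * carving_width G"
proof (cases "card (verts G) \<le> 1")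
  case True
  have "card (ends G e) \<le> 1" if "e \<in> edges G" for e
    using card_mono[OF finite_verts ends_in_verts[OF that]] True by simp
  then have "edges G = {}"
    using card_ends assms by (fastforce simp: loopless_def)
  then have "edges (torso G T X t) = {}" for T :: "(nat, nat) mgraph" and X t
    by (simp add: torso_def)
  then have "tree_cut_torso_width G \<le> 0"
    unfolding tree_cut_torso_width_le_iff using exists_decomposition by simp
  then show ?thesis by simp
next
  case False
  have "\<exists>w. \<exists>(T :: (nat, nat) mgraph) X. carving G T X \<and> adhesion G T X \<le> w"
    using carving_if_torso_width_le False by fastforce
  from LeastI_ex[OF this] obtain T :: "(nat, nat) mgraph" and X where
    TX: "carving G T X" "adhesion G T X \<le> carving_width G"
    using False unfolding carving_width_def by auto
  interpret tree_cut G T X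
    by unfold_locales (use TX in \<open>simp add: carving_def weak_carving_def\<close>)
  have "card (edges (torso G T X t)) \<le> 3 * carving_width G div 2" if "t \<in> verts T" for t
    using torso_edges_carving[OF TX(1) assms that] TX(2) by linarith
  then have "tree_cut_torso_width G \<le> 3 * carving_width G div 2"
    unfolding tree_cut_torso_width_le_iff using decomposition by blast
  then show ?thesis by linarith
qed

text \<open>The axiom on incident edges says that a set meeting fewer than \<open>k\<close> edges is never a large
  side. It holds because such sets are pieces and so small, and the two sides of a cut, which
  together cover the graph, cannot both be small.\<close>

lemma edge_tangle_if_not_assembled:
  assumes pos: "k \<ge> 1"
    and not_assembled:
      "\<not> assembled (low k) (\<lambda>S. S \<subseteq> verts G \<and> card (incident_edges G S) < k) (verts G)"
  obtains \<E> where "edge_tangle G k \<E>"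
proof -
  define L where "L = (\<lambda>S. S \<subseteq> verts G \<and> card (incident_edges G S) < k)"
  have finite_inc: "finite (incident_edges G S)" for S
    using finite_edges by (simp add: incident_edges_def)
  have L_low: "low k S" if "L S" for S
  proof -
    have "cut_size G S \<le> card (incident_edges G S)"
      unfolding cut_size_def
      by (rule card_mono[OF finite_inc]) (auto simp: crossing_def incident_edges_def)
    with that show ?thesis by (auto simp: low_def L_def)
  qed
  have L_subset: "L B" if "L A" "B \<subseteq> A" for A B
  proof -
    have "card (incident_edges G B) \<le> card (incident_edges G A)"
      by (rule card_mono[OF finite_inc]) (use that in \<open>auto simp: incident_edges_def\<close>)
    with that show ?thesis by (auto simp: L_def)
  qed
  have L_empty: "L {}"
    using pos by (simp add: L_def incident_edges_def)
  have "\<exists>F. (\<forall>A. L A \<longrightarrow> A \<in> F) \<and> (\<forall>A\<in>F. low k A) \<and>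
      (\<forall>A. low k A \<longrightarrow> A \<in> F \<or> verts G - A \<in> F) \<and>
      (\<forall>A\<in>F. \<forall>B\<in>F. \<forall>C\<in>F. A \<union> B \<union> C \<noteq> verts G)"
  proof (rule tangle_if_not_assembled)
    show "\<not> assembled (low k) L (verts G)"
      using not_assembled by (simp add: L_def)
    show "low k A" if "L A" for A using that by (rule L_low)
    show "L B" if "L A" "B \<subseteq> A" for A B using that by (rule L_subset)
  qed (fact L_empty)
  then obtain F where F: "\<forall>A. L A \<longrightarrow> A \<in> F" "\<forall>A\<in>F. low k A"
      "\<forall>A. low k A \<longrightarrow> A \<in> F \<or> verts G - A \<in> F"
      "\<forall>A\<in>F. \<forall>B\<in>F. \<forall>C\<in>F. A \<union> B \<union> C \<noteq> verts G"
    by (elim exE conjE)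
  have L: "A \<in> F" if "L A" for A using F(1) that by simp
  have low: "low k A" if "A \<in> F" for A using F(2) that by simp
  have decided: "A \<in> F \<or> verts G - A \<in> F" if "low k A" for A using F(3) that by simp
  have cover: "A \<union> B \<union> C \<noteq> verts G" if "A \<in> F" "B \<in> F" "C \<in> F" for A B C
    using F(4) that by simp
  define \<E> where "\<E> = (\<lambda>A. (A, verts G - A)) ` F"
  have in_E: "(A, B) \<in> \<E> \<longleftrightarrow> A \<in> F \<and> B = verts G - A" for A B
    by (auto simp: \<E>_def)
  have sub: "A \<subseteq> verts G" if "A \<in> F" for A
    using low[OF that] by (simp add: low_def)
  have "edge_tangle G k \<E>"
    unfolding edge_tangle_def edge_cut_low_iff
  proof (intro conjI)
    show "\<forall>(A, B)\<in>\<E>. low k A \<and> B = verts G - A"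
      using low by (auto simp: in_E)
    show "\<forall>A B. low k A \<and> B = verts G - A \<longrightarrow> (A, B) \<in> \<E> \<or> (B, A) \<in> \<E>"
      using decided by (auto simp: in_E low_def double_diff)
    show "\<forall>A1 B1 A2 B2 A3 B3. (A1, B1) \<in> \<E> \<and> (A2, B2) \<in> \<E> \<and> (A3, B3) \<in> \<E> \<longrightarrow>
        B1 \<inter> B2 \<inter> B3 \<noteq> {}"
    proof (intro allI impI)
      fix A1 B1 A2 B2 A3 B3
      assume "(A1, B1) \<in> \<E> \<and> (A2, B2) \<in> \<E> \<and> (A3, B3) \<in> \<E>"
      then have A: "A1 \<in> F" "A2 \<in> F" "A3 \<in> F"
        and B: "B1 \<inter> B2 \<inter> B3 = verts G - (A1 \<union> A2 \<union> A3)"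
        by (auto simp: in_E)
      have "A1 \<union> A2 \<union> A3 \<subset> verts G"
        using cover[OF A] sub A by auto
      then show "B1 \<inter> B2 \<inter> B3 \<noteq> {}"
        unfolding B by auto
    qed
    show "\<forall>(A, B)\<in>\<E>. k \<le> card (incident_edges G B)"
    proof (intro ballI, clarify, rule ccontr)
      fix A B assume AB: "(A, B) \<in> \<E>" and "\<not> k \<le> card (incident_edges G B)"
      then have "B \<in> F"
        using L[of B] by (auto simp: in_E L_def)
      then show False
        using cover[of A B B] AB sub[of A] by (auto simp: in_E)
    qed
  qed (use pos in simp)
  with that show ?thesis .
qed

lemma torso_width_le_if_no_edge_tangle:
  assumes pos: "k \<ge> 1" and no: "\<nexists>\<E>. edge_tangle G k \<E>"
  shows "tree_cut_torso_width G \<le> 2 * (k - 1)"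
proof -
  let ?L = "\<lambda>S. S \<subseteq> verts G \<and> card (incident_edges G S) < k"
  have "assembled (low k) ?L (verts G)"
    using edge_tangle_if_not_assembled[OF pos] no by blast
  from assembled_imp_heap_layout[OF this, of 1] obtain N Y where
    NY: "heap_layout (low k) ?L 1 N Y" "Y 1 = verts G" by auto
  interpret heap: heap G ?L k N Y by unfold_locales (fact NY)
  have "card (edges (torso G heap.T heap.bag t)) \<le> 2 * (k - 1)" if "t \<in> verts heap.T" for t
    using heap.torso_edges_heap[OF NY(2) _ that] by simp
  then show ?thesis
    unfolding tree_cut_torso_width_le_iff using heap.decomposition by blast
qed

end

theorem proposition1p9:
  fixes G :: "('v, 'e) mgraph" and w :: nat
  assumes "multigraph G"
  shows "(tree_cut_torso_width G \<le> w \<longrightarrow>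
            carving_width G \<le> w \<and> (\<nexists>\<E>. edge_tangle G (w + 1) \<E>)) \<and>
         (carving_width G \<le> w \<and> loopless G \<longrightarrow>
            real (tree_cut_torso_width G) \<le> 3 * real w / 2) \<and>
         (w \<ge> 1 \<and> (\<nexists>\<E>. edge_tangle G w \<E>) \<longrightarrow>
            tree_cut_torso_width G \<le> 3 * w - 3)"
proof -
  interpret multigraph G by (fact assms)
  show ?thesis
  proof (intro conjI impI)
    assume "tree_cut_torso_width G \<le> w"
    then show "carving_width G \<le> w" "\<nexists>\<E>. edge_tangle G (w + 1) \<E>"
      using carving_width_le_torso_width no_edge_tangle_if_torso_width_le by (auto intro: order_trans)
  next
    assume "carving_width G \<le> w \<and> loopless G"
    then have "2 * tree_cut_torso_width G \<le> 3 * w"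
      using torso_width_le_carving_width by fastforce
    then show "real (tree_cut_torso_width G) \<le> 3 * real w / 2"
      by linarith
  next
    assume "w \<ge> 1 \<and> (\<nexists>\<E>. edge_tangle G w \<E>)"
    then have "tree_cut_torso_width G \<le> 2 * (w - 1)"
      using torso_width_le_if_no_edge_tangle by blast
    then show "tree_cut_torso_width G \<le> 3 * w - 3"
      by linarith
  qed
qed

end
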